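(* Let $G$ be a local Lie group acting on a neighbourhood of $0\in\mathbb{R}^{p+q}_{x,u}$, with $x\in\mathbb{R}^p$ and $u\in\mathbb{R}^q$, and acting on graphs $\{u=u(x)\}$ and, by prolongation, on the jet spaces $J^n_{p,q}$. Assume $G$ contains all translations $(x^i,u^\alpha)\mapsto(x^i+\mathsf a^i,u^\alpha+\mathsf b^\alpha)$ and all vertical transvections $(x^i,u^\alpha)\mapsto\big(x^i,\,u^\alpha+\sum_{1\le i\le p}\mathsf c^\alpha_i x^i\big)$. Then for every jet order $n\ge0$, all differential invariants of $G$ of order $n$ are independent of $x^i$, $u^\alpha$, $u^\beta_{x^j}$: $$\mathsf I=\mathsf I\Big(\big\{u^\gamma_{x^J}\big\}_{2\le|J|\le n}^{1\le\gamma\le q}\Big),$$ and there is a one-to-one correspondence between differential invariants of $G$ and power series invariants of $G$, given by evaluation at the origin (replacing the jet coordinates $u^\gamma_{x^J}$ by the Taylor coefficients $F^\gamma_J=\partial_x^Ju^\gamma(0)$).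
   Context: $J^n_{p,q}$ is the space of $n$-jets of maps $\mathbb{R}^p\ni x\mapsto u(x)\in\mathbb{R}^q$, with coordinates $x^i$, $u^\alpha$, $u^\beta_{x^J}$, where $J\in\mathbb{N}^p$, $1\le|J|\le n$. A differential invariant of order $n$ is a (locally defined) real-valued function on $J^n_{p,q}$ constant along orbits of the prolonged action of $G$. Power series invariants of $G$: let $G_0\subset G$ be the isotropy subgroup of the origin. A graph through the origin $u^\alpha=\sum_{|J|\ge1}F^\alpha_J\frac{x^J}{J!}$ is transformed by $g_0\in G_0$ (close to the identity) into a graph $v^\beta=\sum_{|K|\ge1}G^\beta_K\frac{y^K}{K!}$ with coefficients $G^\beta_K=G^\beta_K\big(g_0,\{F^\gamma_L\}_{1\le|L|\le|K|}\big)$. A power series invariant of order $n$ is a function $\mathsf I\big(\{F^\alpha_J\}_{1\le|J|\le n}^{1\le\alpha\le q}\big)$ with $\mathsf I(\{G^\beta_K(g_0,\cdot)\})=\mathsf I(\{F^\alpha_J\})$ for all $g_0\in G_0$. *)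

theory Defs
  imports "HOL-Analysis.Analysis"
begin

text \<open>On an open set of a finite-dimensional space, \<open>Ck_on k S f\<close> says that \<open>f\<close> is of class
  \<open>C\<^sup>k\<close> on \<open>S\<close>.\<close>

primrec Ck_on :: "nat \<Rightarrow> 'a::euclidean_space set \<Rightarrow> ('a \<Rightarrow> 'b::euclidean_space) \<Rightarrow> bool" where
  "Ck_on 0 S f \<longleftrightarrow> continuous_on S f"
| "Ck_on (Suc k) S f \<longleftrightarrow>
     f differentiable_on S \<and> (\<forall>v. Ck_on k S (\<lambda>x. frechet_derivative f (at x) v))"

definition smooth_on :: "'a::euclidean_space set \<Rightarrow> ('a \<Rightarrow> 'b::euclidean_space) \<Rightarrow> bool" where
  "smooth_on S f \<longleftrightarrow> (\<forall>k. Ck_on k S f)"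

definition partial_deriv :: "'p::finite \<Rightarrow> (real^'p \<Rightarrow> real^'q::finite) \<Rightarrow> real^'p \<Rightarrow> real^'q" where
  "partial_deriv i f x = frechet_derivative f (at x) (axis i 1)"

primrec iter_partial :: "'p::finite list \<Rightarrow> (real^'p \<Rightarrow> real^'q::finite) \<Rightarrow> real^'p \<Rightarrow> real^'q" where
  "iter_partial [] f = f"
| "iter_partial (i # is) f = partial_deriv i (iter_partial is f)"

text \<open>A multi-index \<open>J \<in> \<nat>\<^sup>p\<close> has type \<open>nat^'p\<close>. Its partial derivative differentiates
  \<open>J\<^sub>i\<close> times in each direction \<open>i\<close>; the index type carries no order, so some order of
  differentiation is chosen. By symmetry of mixed partial derivatives the choice is immaterial
  for smooth functions, the only ones to which this is applied.\<close>

definition multi_deriv :: "nat^'p::finite \<Rightarrow> (real^'p \<Rightarrow> real^'q::finite) \<Rightarrow> real^'p \<Rightarrow> real^'q" where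
  "multi_deriv J f = iter_partial (SOME is. \<forall>i. count_list is i = J $ i) f"

definition mi_size :: "nat^'p::finite \<Rightarrow> nat" where
  "mi_size J = (\<Sum>i\<in>UNIV. J $ i)"

text \<open>A local Lie group, in one coordinate chart: the elements form an open set \<open>V\<close>, the product
  is defined on \<open>\<Omega> \<subseteq> V \<times> V\<close> and the inverse on \<open>\<Lambda> \<subseteq> V\<close>.\<close>

definition local_lie_group ::
  "'g::euclidean_space set \<Rightarrow> 'g \<Rightarrow> ('g \<times> 'g) set \<Rightarrow> ('g \<Rightarrow> 'g \<Rightarrow> 'g) \<Rightarrow> 'g set \<Rightarrow> ('g \<Rightarrow> 'g) \<Rightarrow> bool"
where
  "local_lie_group V e \<Omega> mul \<Lambda> ginv \<longleftrightarrow>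
     open V \<and> e \<in> V \<and>
     open \<Omega> \<and> \<Omega> \<subseteq> V \<times> V \<and> {e} \<times> V \<subseteq> \<Omega> \<and> V \<times> {e} \<subseteq> \<Omega> \<and>
     (\<forall>(g, h)\<in>\<Omega>. mul g h \<in> V) \<and> smooth_on \<Omega> (\<lambda>(g, h). mul g h) \<and>
     open \<Lambda> \<and> e \<in> \<Lambda> \<and> \<Lambda> \<subseteq> V \<and> (\<forall>g\<in>\<Lambda>. ginv g \<in> V) \<and> smooth_on \<Lambda> ginv \<and>
     (\<forall>g\<in>V. mul e g = g \<and> mul g e = g) \<and>
     (\<forall>g\<in>\<Lambda>. (g, ginv g) \<in> \<Omega> \<and> (ginv g, g) \<in> \<Omega> \<and> mul g (ginv g) = e \<and> mul (ginv g) g = e) \<and>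
     (\<forall>g h k. (g, h) \<in> \<Omega> \<and> (h, k) \<in> \<Omega> \<and> (mul g h, k) \<in> \<Omega> \<and> (g, mul h k) \<in> \<Omega> \<longrightarrow>
        mul (mul g h) k = mul g (mul h k))"

text \<open>In a local action, \<open>act g z\<close> is only meaningful for \<open>(g, z) \<in> D\<close>.\<close>

definition local_action ::
  "'g::euclidean_space set \<Rightarrow> 'g \<Rightarrow> ('g \<times> 'g) set \<Rightarrow> ('g \<Rightarrow> 'g \<Rightarrow> 'g) \<Rightarrow>
   'z::euclidean_space set \<Rightarrow> ('g \<times> 'z) set \<Rightarrow> ('g \<Rightarrow> 'z \<Rightarrow> 'z) \<Rightarrow> bool"
where
  "local_action V e \<Omega> mul M D act \<longleftrightarrow>
     open M \<and> open D \<and> D \<subseteq> V \<times> M \<and> {e} \<times> M \<subseteq> D \<and>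
     (\<forall>(g, z)\<in>D. act g z \<in> M) \<and> smooth_on D (\<lambda>(g, z). act g z) \<and>
     (\<forall>z\<in>M. act e z = z) \<and>
     (\<forall>g h z. (h, z) \<in> D \<and> (g, h) \<in> \<Omega> \<and> (g, act h z) \<in> D \<and> (mul g h, z) \<in> D \<longrightarrow>
        act g (act h z) = act (mul g h) z)"

text \<open>For a local group, containing all transformations \<open>T s\<close> of a family with
  \<open>T 0 = id\<close> means: those with small parameter \<open>s\<close> are realized, wherever the local action is
  defined, by group elements close to the identity.\<close>

definition contains_family ::
  "'g::euclidean_space \<Rightarrow> ('g \<times> 'z) set \<Rightarrow> ('g \<Rightarrow> 'z \<Rightarrow> 'z) \<Rightarrow>
   ('s::euclidean_space \<Rightarrow> 'z \<Rightarrow> 'z::euclidean_space) \<Rightarrow> bool"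
where
  "contains_family e D act T \<longleftrightarrow>
     (\<forall>N. open N \<and> e \<in> N \<longrightarrow>
        (\<forall>\<^sub>F s in nhds 0. \<exists>g\<in>N. \<forall>z. (g, z) \<in> D \<longrightarrow> act g z = T s z))"

definition translation :: "(real^'p) \<times> (real^'q) \<Rightarrow> (real^'p) \<times> (real^'q) \<Rightarrow> (real^'p) \<times> (real^'q)" where
  "translation s z = z + s"

definition transvection :: "real^'p::finite^'q \<Rightarrow> (real^'p) \<times> (real^'q) \<Rightarrow> (real^'p) \<times> (real^'q)" where
  "transvection c = (\<lambda>(x, u). (x, u + c *v x))"

text \<open>A jet of order \<open>n\<close> is written \<open>((x, u), F)\<close>, where \<open>F J\<close> is the coordinate vector
  \<open>(u\<^sup>\<alpha>\<^bsub>x^J\<^esub>)\<^sub>\<alpha>\<close> for \<open>1 \<le> |J| \<le> n\<close> and, by convention, \<open>F J = 0\<close> for all other \<open>J\<close>.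
  The subspace topology of the product topology on these functions is the Euclidean one.\<close>

type_synonym ('p, 'q) coeffs = "nat^'p \<Rightarrow> real^'q"
type_synonym ('p, 'q) jet = "((real^'p) \<times> (real^'q)) \<times> ('p, 'q) coeffs"

definition coeff_space :: "nat \<Rightarrow> ('p::finite, 'q::finite) coeffs set" where
  "coeff_space n = {F. \<forall>J. \<not> (1 \<le> mi_size J \<and> mi_size J \<le> n) \<longrightarrow> F J = 0}"

definition jet_space :: "((real^'p) \<times> (real^'q)) set \<Rightarrow> nat \<Rightarrow> ('p::finite, 'q::finite) jet set" where
  "jet_space M n = M \<times> coeff_space n"

definition taylor_coeffs ::
  "nat \<Rightarrow> (real^'p \<Rightarrow> real^'q) \<Rightarrow> real^'p \<Rightarrow> ('p::finite, 'q::finite) coeffs" where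
  "taylor_coeffs n u x =
     (\<lambda>J. if 1 \<le> mi_size J \<and> mi_size J \<le> n then multi_deriv J u x else 0)"

definition jet_of :: "nat \<Rightarrow> (real^'p \<Rightarrow> real^'q) \<Rightarrow> real^'p \<Rightarrow> ('p::finite, 'q::finite) jet" where
  "jet_of n u x = ((x, u x), taylor_coeffs n u x)"

definition transforms_graph ::
  "('g \<times> ((real^'p::finite) \<times> (real^'q::finite))) set \<Rightarrow>
   ('g \<Rightarrow> (real^'p) \<times> (real^'q) \<Rightarrow> (real^'p) \<times> (real^'q)) \<Rightarrow> 'g \<Rightarrow>
   (real^'p) set \<Rightarrow> (real^'p \<Rightarrow> real^'q) \<Rightarrow> (real^'p) set \<Rightarrow> (real^'p \<Rightarrow> real^'q) \<Rightarrow> bool"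
where
  "transforms_graph D act g A u B v \<longleftrightarrow>
     open A \<and> smooth_on A u \<and> open B \<and> smooth_on B v \<and>
     (\<forall>x\<in>A. (g, (x, u x)) \<in> D) \<and>
     (\<lambda>x. act g (x, u x)) ` A = (\<lambda>y. (y, v y)) ` B"

text \<open>The prolonged action as a relation: \<open>g\<close> sends the jet \<open>z\<close> to the jet \<open>z'\<close>. By the chain
  rule \<open>z'\<close> does not depend on the representative \<open>u\<close> of \<open>z\<close>; there is no \<open>z'\<close> if \<open>g\<close> is
  not defined at \<open>z\<close> or turns the graph of \<open>u\<close> into something that is not a graph near there.\<close>

definition prolonged_action ::
  "('g \<times> ((real^'p::finite) \<times> (real^'q::finite))) set \<Rightarrow>
   ('g \<Rightarrow> (real^'p) \<times> (real^'q) \<Rightarrow> (real^'p) \<times> (real^'q)) \<Rightarrow> nat \<Rightarrow> 'g \<Rightarrow>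
   ('p, 'q) jet \<Rightarrow> ('p, 'q) jet \<Rightarrow> bool"
where
  "prolonged_action D act n g z z' \<longleftrightarrow>
     (\<exists>A u B v x y. transforms_graph D act g A u B v \<and> x \<in> A \<and> y \<in> B \<and>
        act g (x, u x) = (y, v y) \<and> z = jet_of n u x \<and> z' = jet_of n v y)"

text \<open>Real-valued functions on a domain \<open>U\<close> of the jet space are represented extensionally.
  Since group and function are only locally defined, constancy along the orbits means invariance,
  at each jet \<open>z \<in> U\<close>, under the group elements close to the identity.\<close>

definition differential_invariants ::
  "'g::euclidean_space \<Rightarrow> ('g \<times> ((real^'p::finite) \<times> (real^'q::finite))) set \<Rightarrow>
   ('g \<Rightarrow> (real^'p) \<times> (real^'q) \<Rightarrow> (real^'p) \<times> (real^'q)) \<Rightarrow> nat \<Rightarrow>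
   ('p, 'q) jet set \<Rightarrow> (('p, 'q) jet \<Rightarrow> real) set"
where
  "differential_invariants e D act n U =
     {I \<in> extensional U. \<forall>z\<in>U. \<forall>\<^sub>F g in nhds e.
        \<forall>z'\<in>U. prolonged_action D act n g z z' \<longrightarrow> I z' = I z}"

definition isotropy ::
  "('g \<times> 'z) set \<Rightarrow> ('g \<Rightarrow> 'z \<Rightarrow> 'z) \<Rightarrow> 'z \<Rightarrow> 'g set" where
  "isotropy D act z = {g. (g, z) \<in> D \<and> act g z = z}"

text \<open>\<open>g\<close> transforms a graph through the origin whose Taylor coefficients up to order \<open>n\<close> are
  \<open>F\<close> into one with Taylor coefficients \<open>G\<close>. Taylor coefficients are partial derivatives at the
  origin: the series is \<open>\<Sum>\<^sub>J F\<^sub>J x\<^sup>J / J!\<close>.\<close>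

definition power_series_action ::
  "('g \<times> ((real^'p::finite) \<times> (real^'q::finite))) set \<Rightarrow>
   ('g \<Rightarrow> (real^'p) \<times> (real^'q) \<Rightarrow> (real^'p) \<times> (real^'q)) \<Rightarrow> nat \<Rightarrow> 'g \<Rightarrow>
   ('p, 'q) coeffs \<Rightarrow> ('p, 'q) coeffs \<Rightarrow> bool"
where
  "power_series_action D act n g F G \<longleftrightarrow>
     (\<exists>A u B v. transforms_graph D act g A u B v \<and>
        0 \<in> A \<and> u 0 = 0 \<and> 0 \<in> B \<and> v 0 = 0 \<and>
        F = taylor_coeffs n u 0 \<and> G = taylor_coeffs n v 0)"

definition power_series_invariants ::
  "'g::euclidean_space \<Rightarrow> ('g \<times> ((real^'p::finite) \<times> (real^'q::finite))) set \<Rightarrow>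
   ('g \<Rightarrow> (real^'p) \<times> (real^'q) \<Rightarrow> (real^'p) \<times> (real^'q)) \<Rightarrow> nat \<Rightarrow>
   ('p, 'q) coeffs set \<Rightarrow> (('p, 'q) coeffs \<Rightarrow> real) set"
where
  "power_series_invariants e D act n W =
     {I \<in> extensional W. \<forall>F\<in>W. \<forall>\<^sub>F g in nhds e. g \<in> isotropy D act 0 \<longrightarrow>
        (\<forall>G\<in>W. power_series_action D act n g F G \<longrightarrow> I G = I F)}"

definition higher_coords :: "('p::finite, 'q::finite) jet \<Rightarrow> ('p, 'q) coeffs" where
  "higher_coords z = (\<lambda>J. if 2 \<le> mi_size J then snd z J else 0)"

definition depends_only_on_higher ::
  "('p::finite, 'q::finite) jet set \<Rightarrow> (('p, 'q) jet \<Rightarrow> real) \<Rightarrow> bool" where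
  "depends_only_on_higher U I \<longleftrightarrow> (\<exists>h. \<forall>z\<in>U. I z = h (higher_coords z))"

definition origin_fibre :: "('p::finite, 'q::finite) jet set \<Rightarrow> ('p, 'q) coeffs set" where
  "origin_fibre U = {F. (0, F) \<in> U}"

definition eval_at_origin ::
  "('p::finite, 'q::finite) jet set \<Rightarrow> (('p, 'q) jet \<Rightarrow> real) \<Rightarrow> ('p, 'q) coeffs \<Rightarrow> real" where
  "eval_at_origin U I = (\<lambda>F\<in>origin_fibre U. I (0, F))"

end

theory Submission
  imports Defs
begin

text \<open>Every jet is the jet of a translated Taylor polynomial, so a small translation moves the base
  point of any jet and fixes its coefficients, while a transvection changes only \<open>u\<close> and the
  first-order coefficients. An invariant is therefore locally constant in all these coordinates;
  since the size of the admissible group elements depends on the jet, passing from this to constancy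
  needs connectedness.

  Conversely, let \<open>J\<close> be a power series invariant and extend it to jets by forgetting the base
  point. If \<open>g\<close> is close to \<open>e\<close> and maps a jet at \<open>0\<close> to a jet at \<open>b\<close>, then the
  translation by \<open>- b\<close> composed with \<open>g\<close> lies in the isotropy group of \<open>0\<close>, which gives
  invariance at jets over \<open>0\<close>. Invariance at other base points, which no single translation in
  the local group need reach from \<open>0\<close>, propagates along the connected fibre by conjugating
  \<open>g\<close> with small translations.\<close>

section \<open>Jets of translated graphs and Taylor polynomials\<close>

text \<open>Moves the whole graph of \<open>u\<close> by the vector \<open>s\<close>; the argument
  is shifted back because the domain moves along.\<close>

definition graph_shift :: "(real^'p) \<times> (real^'q) \<Rightarrow> (real^'p \<Rightarrow> real^'q) \<Rightarrow> real^'p \<Rightarrow> real^'q" where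
  "graph_shift s u = (\<lambda>x. u (x - fst s) + snd s)"

lemma has_derivative_shift_iff:
  fixes f :: "'a::real_normed_vector \<Rightarrow> 'b::real_normed_vector"
  shows "((\<lambda>x. f (x - a) + b) has_derivative f') (at x) \<longleftrightarrow> (f has_derivative f') (at (x - a))"
proof -
  have *: "((\<lambda>x. f (x - a) + b) has_derivative f') (at x)"
    if "(f has_derivative f') (at (x - a))" for f :: "'a \<Rightarrow> 'b" and a b x
  proof -
    have 1: "((\<lambda>x. x - a) has_derivative (\<lambda>h. h)) (at x)"
      by (auto intro!: derivative_eq_intros)
    have "((\<lambda>x. f (x - a)) has_derivative (\<lambda>h. f' h)) (at x)"
      using has_derivative_compose[OF 1 that] .
    then show ?thesis
      by (auto intro!: derivative_eq_intros)
  qed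
  have "(f has_derivative f') (at (x - a))" if "((\<lambda>x. f (x - a) + b) has_derivative f') (at x)"
    using *[of "\<lambda>x. f (x - a) + b" "x - a" "- a" "- b"] that by simp
  with * show ?thesis by blast
qed

text \<open>Both sides are choices from the same predicate, so the identity also covers points where
  \<open>f\<close> fails to be differentiable, and iterated partials can be shifted for arbitrary
  \<open>u\<close>.\<close>

lemma frechet_derivative_shift:
  fixes f :: "'a::real_normed_vector \<Rightarrow> 'b::real_normed_vector"
  shows "frechet_derivative (\<lambda>x. f (x - a) + b) (at x) = frechet_derivative f (at (x - a))"
  unfolding frechet_derivative_def has_derivative_shift_iff ..

text \<open>The first differentiation removes the constant \<open>snd s\<close>, so only nonempty
  lists qualify; from then on the shift sits in the argument alone.\<close>

lemma iter_partial_shift: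
  assumes "is \<noteq> []"
  shows "iter_partial is (graph_shift s u) = (\<lambda>x. iter_partial is u (x - fst s))"
  using assms
proof (induction "is")
  case (Cons i "is")
  show ?case
  proof (cases "is = []")
    case True
    then show ?thesis
      by (simp add: graph_shift_def partial_deriv_def fun_eq_iff frechet_derivative_shift)
  next
    case False
    then show ?thesis
      using frechet_derivative_shift[where f = "iter_partial is u" and a = "fst s" and b = 0]
      unfolding iter_partial.simps Cons.IH[OF False] partial_deriv_def by simp
  qed
qed simp

lemma ex_list_count:
  fixes J :: "'p::finite \<Rightarrow> nat"
  shows "\<exists>is. \<forall>i. count_list is i = J i"
proof -
  obtain "is" where "mset is = Abs_multiset J"
    using ex_mset by blast
  moreover have "count (Abs_multiset J) = J"
    by (rule Abs_multiset_inverse) simp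
  ultimately have "\<forall>i. count_list is i = J i"
    by (metis count_mset)
  then show ?thesis by blast
qed

text \<open>A single list serves all functions at once, so derivatives of different functions are
  compared along the same order of differentiation.\<close>

lemma multi_deriv_cases:
  fixes J :: "nat^'p::finite"
  obtains "is" where "\<And>i. count_list is i = J $ i"
    "\<And>f :: real^'p \<Rightarrow> real^'q. multi_deriv J f = iter_partial is f"
proof
  show "count_list (SOME is. \<forall>i. count_list is i = J $ i) i = J $ i" for i
    using someI_ex[OF ex_list_count[of "($) J"]] by blast
qed (rule multi_deriv_def)

lemma multi_deriv_shift:
  fixes u :: "real^'p::finite \<Rightarrow> real^'q::finite"
  assumes "1 \<le> mi_size J"
  shows "multi_deriv J (graph_shift s u) x = multi_deriv J u (x - fst s)"
proof -
  obtain "is" where "is": "\<And>i. count_list is i = J $ i"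
    "\<And>f :: real^'p \<Rightarrow> real^'q. multi_deriv J f = iter_partial is f"
    using multi_deriv_cases by blast
  have "is \<noteq> []"
    using assms "is"(1) by (auto simp: mi_size_def)
  then show ?thesis
    by (simp add: "is"(2) iter_partial_shift)
qed

lemma taylor_coeffs_shift:
  "taylor_coeffs n (graph_shift s u) x = taylor_coeffs n u (x - fst s)"
  by (auto simp: taylor_coeffs_def multi_deriv_shift)

lemma jet_of_shift:
  "jet_of n (graph_shift s u) (x + fst s) = ((x, u x) + s, taylor_coeffs n u x)"
  by (simp add: jet_of_def taylor_coeffs_shift) (simp add: graph_shift_def prod_eq_iff)

section \<open>Smoothness of translated graphs\<close>

lemma Ck_on_subset: "Ck_on k S f \<Longrightarrow> T \<subseteq> S \<Longrightarrow> Ck_on k T f"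
proof (induction k arbitrary: f)
  case 0
  then show ?case using continuous_on_subset by auto
next
  case (Suc k)
  then show ?case
    unfolding Ck_on.simps using differentiable_on_subset by blast
qed

lemma smooth_on_subset: "smooth_on S f \<Longrightarrow> T \<subseteq> S \<Longrightarrow> smooth_on T f"
  unfolding smooth_on_def using Ck_on_subset by blast

lemma smooth_on_imp_continuous_on: "smooth_on S f \<Longrightarrow> continuous_on S f"
  unfolding smooth_on_def by (metis Ck_on.simps(1))

text \<open>\<open>b\<close> stays arbitrary in the induction because differentiation turns it into
  0.\<close>

lemma Ck_on_shift:
  "Ck_on k S f \<Longrightarrow> Ck_on k ((\<lambda>x. x + a) ` S) (\<lambda>x. f (x - a) + b)"
proof (induction k arbitrary: f b)
  case 0
  have "continuous_on ((\<lambda>x. x + a) ` S) (\<lambda>x. f (x - a))"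
  proof (rule continuous_on_compose2[of S f])
    show "continuous_on S f"
      using 0 by simp
    show "continuous_on ((\<lambda>x. x + a) ` S) (\<lambda>x. x - a)"
      by (intro continuous_intros)
  qed auto
  then show ?case
    unfolding Ck_on.simps by (intro continuous_on_add continuous_on_const)
next
  case (Suc k)
  have "(\<lambda>x. x - a) differentiable_on (\<lambda>x. x + a) ` S"
    by (intro differentiable_on_diff differentiable_on_ident differentiable_on_const)
  moreover have "f differentiable_on (\<lambda>x. x - a) ` (\<lambda>x. x + a) ` S"
    using Suc.prems by (simp add: image_image)
  ultimately have "(\<lambda>x. f (x - a) + b) differentiable_on ((\<lambda>x. x + a) ` S)"
    using differentiable_on_compose by (intro differentiable_on_add differentiable_on_const) blast
  moreover have "Ck_on k ((\<lambda>x. x + a) ` S) (\<lambda>x. frechet_derivative f (at (x - a)) v)" for v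
    using Suc.IH[of "\<lambda>x. frechet_derivative f (at x) v" 0] Suc.prems by simp
  ultimately show ?case
    by (simp add: frechet_derivative_shift)
qed

lemma smooth_on_graph_shift:
  assumes "smooth_on S u"
  shows "smooth_on ((\<lambda>x. x + fst s) ` S) (graph_shift s u)"
  using assms unfolding smooth_on_def graph_shift_def by (simp add: Ck_on_shift)

section \<open>Taylor polynomials with prescribed coefficients\<close>

lemma Ck_on_const_scaleR:
  "Ck_on k UNIV f \<Longrightarrow> Ck_on k UNIV (\<lambda>x. c *\<^sub>R f x)"
proof (induction k arbitrary: f)
  case 0
  then show ?case by (auto intro: continuous_intros)
next
  case (Suc k)
  then have f: "f differentiable at x" for x
    by (simp add: differentiable_on_def)
  have der: "((\<lambda>x. c *\<^sub>R f x) has_derivative (\<lambda>v. c *\<^sub>R frechet_derivative f (at x) v)) (at x)" for x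
    using f[unfolded frechet_derivative_works] by (rule has_derivative_scaleR_right)
  show ?case
    using Suc differentiableI[OF der]
    by (simp add: differentiable_on_def frechet_derivative_at[OF der, symmetric])
qed

lemma Ck_on_add:
  "Ck_on k UNIV f \<Longrightarrow> Ck_on k UNIV g \<Longrightarrow> Ck_on k UNIV (\<lambda>x. f x + g x)"
proof (induction k arbitrary: f g)
  case 0
  then show ?case by (auto intro: continuous_intros)
next
  case (Suc k)
  then have f: "f differentiable at x" "g differentiable at x" for x
    by (simp_all add: differentiable_on_def)
  have der: "((\<lambda>x. f x + g x) has_derivative
      (\<lambda>v. frechet_derivative f (at x) v + frechet_derivative g (at x) v)) (at x)" for x
    using f[unfolded frechet_derivative_works] by (rule has_derivative_add)
  show ?case
    using Suc differentiableI[OF der]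
    by (simp add: differentiable_on_def frechet_derivative_at[OF der, symmetric])
qed

lemma Ck_on_zero: "Ck_on k UNIV (\<lambda>x. 0)"
  by (induction k) auto

lemma Ck_on_sum:
  assumes "\<And>i. i \<in> T \<Longrightarrow> Ck_on k UNIV (f i)"
  shows "Ck_on k UNIV (\<lambda>x. \<Sum>i\<in>T. f i x)"
  using assms
proof (induction T rule: infinite_finite_induct)
  case (insert i T)
  then show ?case by (simp add: Ck_on_add)
qed (simp_all add: Ck_on_zero)

text \<open>\<open>divided_power k l\<close> is the \<open>l\<close>-th derivative of \<open>x\<^sup>k / k!\<close>, and \<open>monomial_deriv K L\<close> the
  derivative of order \<open>L\<close> of \<open>x\<^sup>K / K!\<close>.\<close>

definition divided_power :: "nat \<Rightarrow> nat \<Rightarrow> real \<Rightarrow> real" where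
  "divided_power k l x = (if l \<le> k then x ^ (k - l) / fact (k - l) else 0)"

lemma divided_power_0: "divided_power k l 0 = (if k = l then 1 else 0)"
  by (auto simp: divided_power_def)

lemma divided_power_deriv:
  "(divided_power k l has_real_derivative divided_power k (Suc l) x) (at x)"
proof (cases "Suc l \<le> k")
  case True
  then obtain d where "k = Suc l + d"
    using le_Suc_ex by blast
  then have d: "k = Suc (l + d)"
    by simp
  have k: "divided_power k l = (\<lambda>x. x ^ Suc d / fact (Suc d))" "divided_power k (Suc l) = (\<lambda>x. x ^ d / fact d)"
    unfolding divided_power_def[abs_def] d by simp_all
  have "(divided_power k l has_real_derivative real (Suc d) * x ^ (Suc d - Suc 0) / fact (Suc d)) (at x)"
    unfolding k by (rule DERIV_cdivide[OF DERIV_pow])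
  moreover have "real (Suc d) * x ^ (Suc d - Suc 0) / fact (Suc d) = x ^ d / fact d"
    by (simp del: of_nat_Suc)
  ultimately show ?thesis
    unfolding k by simp
next
  case False
  then have k: "divided_power k l = (\<lambda>x. if k = l then 1 else 0)" "divided_power k (Suc l) = (\<lambda>x. 0)"
    by (auto simp: divided_power_def fun_eq_iff)
  show ?thesis
    unfolding k by (rule DERIV_const)
qed

definition monomial_deriv :: "nat^'p \<Rightarrow> ('p \<Rightarrow> nat) \<Rightarrow> real^'p::finite \<Rightarrow> real" where
  "monomial_deriv K L x = (\<Prod>i\<in>UNIV. divided_power (K $ i) (L i) (x $ i))"

text \<open>Product rule: differentiating in direction \<open>i\<close> raises the derivative order
  \<open>L i\<close> by one, so the family is closed under differentiation. As \<open>L\<close> is a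
  function and not a vector, \<open>count_list\<close> can take its place later.\<close>

lemma monomial_deriv_has_derivative:
  "(monomial_deriv K L has_derivative
     (\<lambda>v. \<Sum>i\<in>UNIV. v $ i * monomial_deriv K (L(i := Suc (L i))) x)) (at x)"
proof -
  have 1: "((\<lambda>x. divided_power (K $ i) (L i) (x $ i)) has_derivative
      (\<lambda>v. divided_power (K $ i) (Suc (L i)) (x $ i) * v $ i)) (at x)" for i
  proof -
    have a: "((\<lambda>x. x $ i) has_derivative (\<lambda>v. v $ i)) (at x)"
      by (rule bounded_linear_imp_has_derivative[OF bounded_linear_vec_nth])
    have b: "(divided_power (K $ i) (L i) has_derivative
        (*) (divided_power (K $ i) (Suc (L i)) (x $ i))) (at (x $ i))"
      using divided_power_deriv unfolding has_field_derivative_def .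
    show ?thesis
      using has_derivative_compose[OF a b] .
  qed
  have 2: "monomial_deriv K (L(i := Suc (L i))) x =
    divided_power (K $ i) (Suc (L i)) (x $ i) *
      (\<Prod>j\<in>UNIV - {i}. divided_power (K $ j) (L j) (x $ j))" for i
    unfolding monomial_deriv_def
    by (rule trans[OF prod.remove[where x = i]]) (auto intro!: prod.cong)
  show ?thesis
    unfolding monomial_deriv_def[of K L, abs_def]
    by (rule has_derivative_eq_rhs[OF has_derivative_prod[OF 1]])
      (simp only: 2 mult_ac)
qed

text \<open>There is no constant term: the polynomial vanishes at 0, and \<open>graph_shift\<close>
  puts its graph through the wanted base point.\<close>

definition taylor_poly :: "nat \<Rightarrow> ('p, 'q) coeffs \<Rightarrow> real^'p::finite \<Rightarrow> real^'q::finite" where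
  "taylor_poly n F x = (\<Sum>K | 1 \<le> mi_size K \<and> mi_size K \<le> n. monomial_deriv K (\<lambda>_. 0) x *\<^sub>R F K)"

lemma finite_mi: "finite {K :: nat^'p::finite. 1 \<le> mi_size K \<and> mi_size K \<le> n}"
proof (rule finite_subset)
  show "finite (vec_lambda ` (UNIV \<rightarrow>\<^sub>E {..n}) :: (nat^'p) set)"
    by (intro finite_imageI finite_PiE) auto
  have "K $ i \<le> mi_size K" for K :: "nat^'p" and i
    unfolding mi_size_def by (rule member_le_sum) auto
  then have "($) K \<in> UNIV \<rightarrow>\<^sub>E {..n}" if "mi_size K \<le> n" for K :: "nat^'p"
    using that by (auto intro: order_trans)
  then show "{K. 1 \<le> mi_size K \<and> mi_size K \<le> n} \<subseteq> (vec_lambda ` (UNIV \<rightarrow>\<^sub>E {..n}) :: (nat^'p) set)"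
    by (metis (mono_tags, lifting) image_eqI mem_Collect_eq subsetI vec_lambda_eta)
qed

lemma monomial_deriv_scaleR_frechet:
  "frechet_derivative (\<lambda>x. monomial_deriv K L x *\<^sub>R c) (at x) v =
     (\<Sum>i\<in>UNIV. v $ i *\<^sub>R (monomial_deriv K (L(i := Suc (L i))) x *\<^sub>R c))"
  "(\<lambda>x. monomial_deriv K L x *\<^sub>R c) differentiable at x"
proof -
  have 1: "((\<lambda>x. monomial_deriv K L x *\<^sub>R c) has_derivative
    (\<lambda>v. (\<Sum>i\<in>UNIV. v $ i * monomial_deriv K (L(i := Suc (L i))) x) *\<^sub>R c)) (at x)"
    by (intro has_derivative_scaleR_left monomial_deriv_has_derivative)
  show "(\<lambda>x. monomial_deriv K L x *\<^sub>R c) differentiable at x"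
    using 1 differentiableI by blast
  show "frechet_derivative (\<lambda>x. monomial_deriv K L x *\<^sub>R c) (at x) v =
     (\<Sum>i\<in>UNIV. v $ i *\<^sub>R (monomial_deriv K (L(i := Suc (L i))) x *\<^sub>R c))"
    by (simp add: frechet_derivative_at[OF 1, symmetric] scaleR_sum_left)
qed

text \<open>\<open>L\<close> is generalised since each directional derivative is a linear
  combination of members with one entry of \<open>L\<close> raised.\<close>

lemma Ck_on_monomial_deriv: "Ck_on k UNIV (\<lambda>x. monomial_deriv K L x *\<^sub>R c)"
proof (induction k arbitrary: L)
  case 0
  show ?case
    using monomial_deriv_scaleR_frechet(2)
    by (auto intro!: continuous_at_imp_continuous_on differentiable_imp_continuous_within)
next
  case (Suc k)
  then show ?case
    using monomial_deriv_scaleR_frechet(2)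
    by (auto simp: differentiable_on_def monomial_deriv_scaleR_frechet(1)
        simp del: scaleR_scaleR intro!: Ck_on_sum Ck_on_const_scaleR)
qed

lemma smooth_taylor_poly: "smooth_on A (taylor_poly n F)"
proof -
  have "Ck_on k UNIV (taylor_poly n F)" for k
    unfolding taylor_poly_def[abs_def] by (intro Ck_on_sum Ck_on_monomial_deriv)
  then show ?thesis
    unfolding smooth_on_def using Ck_on_subset by blast
qed

text \<open>Each partial derivative raises one entry of the derivative order, so after the whole
  list that order is the counting function of the list.\<close>

lemma iter_partial_taylor_poly:
  fixes F :: "('a::finite, 'b::finite) coeffs"
  shows "iter_partial is (taylor_poly n F) =
    (\<lambda>x. \<Sum>K | 1 \<le> mi_size K \<and> mi_size K \<le> n. monomial_deriv K (count_list is) x *\<^sub>R F K)"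
proof (induction "is")
  case Nil
  have "count_list [] = (\<lambda>_ :: 'a. 0)"
    by (rule ext) simp
  then show ?case
    unfolding taylor_poly_def[abs_def] iter_partial.simps by (rule ssubst) (rule refl)
next
  case (Cons i "is")
  have upd: "(count_list is)(i := Suc (count_list is i)) = count_list (i # is)"
    by (simp add: fun_eq_iff)
  have 1: "((\<lambda>x. \<Sum>K | 1 \<le> mi_size K \<and> mi_size K \<le> n. monomial_deriv K (count_list is) x *\<^sub>R F K)
    has_derivative (\<lambda>v. \<Sum>K | 1 \<le> mi_size K \<and> mi_size K \<le> n.
      frechet_derivative (\<lambda>x. monomial_deriv K (count_list is) x *\<^sub>R F K) (at x) v)) (at x)" for x
    by (intro has_derivative_sum monomial_deriv_scaleR_frechet(2)[unfolded frechet_derivative_works])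
  have 2: "frechet_derivative (\<lambda>x. monomial_deriv K (count_list is) x *\<^sub>R F K) (at x) (axis i 1) =
    monomial_deriv K (count_list (i # is)) x *\<^sub>R F K" for K x
  proof -
    have "(\<Sum>j\<in>UNIV. (axis i 1 :: real^'a) $ j *\<^sub>R (f j :: real^'b)) = f i" for f
      by (subst sum.remove[of _ i]) (auto simp: axis_def)
    then show ?thesis
      by (simp only: monomial_deriv_scaleR_frechet(1) upd)
  qed
  show ?case
  proof
    fix x
    have "iter_partial (i # is) (taylor_poly n F) x = frechet_derivative (\<lambda>x. \<Sum>K | 1 \<le> mi_size K \<and> mi_size K \<le> n.
        monomial_deriv K (count_list is) x *\<^sub>R F K) (at x) (axis i 1)"
      by (simp only: iter_partial.simps Cons partial_deriv_def)
    also have "\<dots> = (\<Sum>K | 1 \<le> mi_size K \<and> mi_size K \<le> n.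
        frechet_derivative (\<lambda>x. monomial_deriv K (count_list is) x *\<^sub>R F K) (at x) (axis i 1))"
      by (rule fun_cong[OF frechet_derivative_at[OF 1, symmetric]])
    also have "\<dots> = (\<Sum>K | 1 \<le> mi_size K \<and> mi_size K \<le> n. monomial_deriv K (count_list (i # is)) x *\<^sub>R F K)"
      by (intro sum.cong refl 2)
    finally show "iter_partial (i # is) (taylor_poly n F) x = \<dots>" .
  qed
qed

text \<open>At 0 the derivatives of x^K / K! form a Kronecker delta in \<open>K\<close> and
  \<open>L\<close>; this is what recovers the coefficients of a Taylor polynomial.\<close>

lemma monomial_deriv_0: "monomial_deriv K L 0 = (if \<forall>i. K $ i = L i then 1 else 0)"
  by (auto simp: monomial_deriv_def divided_power_0)

lemma taylor_poly_0: "taylor_poly n F 0 = 0"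
  unfolding taylor_poly_def
  by (rule sum.neutral) (auto simp: monomial_deriv_0 mi_size_def)

lemma taylor_coeffs_taylor_poly:
  fixes F :: "('p::finite, 'q::finite) coeffs"
  assumes "F \<in> coeff_space n"
  shows "taylor_coeffs n (taylor_poly n F) 0 = F"
proof
  fix J
  show "taylor_coeffs n (taylor_poly n F) 0 J = F J"
  proof (cases "1 \<le> mi_size J \<and> mi_size J \<le> n")
    case True
    obtain "is" where "is": "\<And>i. count_list is i = J $ i"
      "\<And>f :: real^'p \<Rightarrow> real^'q. multi_deriv J f = iter_partial is f"
      using multi_deriv_cases by blast
    have "multi_deriv J (taylor_poly n F) 0 =
      (\<Sum>K | 1 \<le> mi_size K \<and> mi_size K \<le> n. if K = J then F K else 0)"
      unfolding "is"(2) iter_partial_taylor_poly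
      by (intro sum.cong) (auto simp: monomial_deriv_0 "is"(1) vec_eq_iff)
    also have "\<dots> = F J"
      using True finite_mi by (subst sum.delta) auto
    finally show ?thesis
      using True by (simp add: taylor_coeffs_def)
  qed (use assms in \<open>auto simp: taylor_coeffs_def coeff_space_def\<close>)
qed

text \<open>Supplies a representative of an arbitrary jet, defined on the whole space.\<close>

lemma jet_of_taylor_poly:
  assumes "F \<in> coeff_space n"
  shows "jet_of n (graph_shift b (taylor_poly n F)) (fst b) = (b, F)"
  using jet_of_shift[of n b "taylor_poly n F" 0]
  by (simp add: taylor_coeffs_taylor_poly[OF assms] taylor_poly_0 prod_eq_iff)

lemma smooth_graph_shift_taylor_poly: "smooth_on A (graph_shift b (taylor_poly n F))"
  using smooth_on_graph_shift[OF smooth_taylor_poly[of UNIV n F], of b]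
  by (rule smooth_on_subset) (simp add: surj_plus_right)

lemma taylor_poly_add_scaleR:
  "taylor_poly n (\<lambda>J. F J + t *\<^sub>R H J) x = taylor_poly n F x + t *\<^sub>R taylor_poly n H x"
  by (simp add: taylor_poly_def sum.distrib scaleR_sum_right algebra_simps)

section \<open>The first-order part of a Taylor polynomial\<close>

lemma mi_size_eq_1:
  fixes K :: "nat^'p::finite"
  shows "mi_size K = 1 \<longleftrightarrow> (\<exists>i. K = axis i 1)"
proof
  assume "mi_size K = 1"
  then obtain i where "K $ i = 1" "\<forall>j. i \<noteq> j \<longrightarrow> K $ j = 0"
    unfolding mi_size_def One_nat_def sum_eq_Suc0_iff[OF finite] by blast
  then show "\<exists>i. K = axis i 1"
    by (auto simp: vec_eq_iff axis_def)
next
  assume "\<exists>i. K = axis i 1"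
  then show "mi_size K = 1"
    by (auto simp: mi_size_def axis_def)
qed

lemma monomial_deriv_axis: "monomial_deriv (axis i 1) (\<lambda>_. 0) x = x $ i"
proof -
  have "monomial_deriv (axis i 1) (\<lambda>_. 0) x = (\<Prod>j\<in>UNIV. if j = i then x $ j else 1)"
    unfolding monomial_deriv_def by (intro prod.cong) (auto simp: divided_power_def axis_def)
  then show ?thesis by simp
qed

text \<open>Only the multi-indices of size 1 survive, and these are the unit vectors
  \<open>axis i 1\<close>. So two coefficient families that agree from order 2 on have Taylor
  polynomials differing by a linear map, as under a transvection.\<close>

lemma taylor_poly_first_order:
  fixes H :: "('p::finite, 'q::finite) coeffs"
  assumes H: "H \<in> coeff_space n" and high: "\<And>J. 2 \<le> mi_size J \<Longrightarrow> H J = 0"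
  obtains c :: "real^'p^'q" where "\<And>x. taylor_poly n H x = c *v x"
proof
  fix x :: "real^'p"
  let ?c = "\<chi> \<alpha> i. H (axis i 1) $ \<alpha>"
  have 0: "H K = 0" if "K \<notin> range (\<lambda>i. axis i 1)" for K
  proof -
    have "mi_size K \<noteq> 1"
      using that mi_size_eq_1[of K] by blast
    then show ?thesis
      using H high[of K] by (cases "mi_size K = 0") (auto simp: coeff_space_def)
  qed
  have "taylor_poly n H x = (\<Sum>K\<in>range (\<lambda>i. axis i 1). monomial_deriv K (\<lambda>_. 0) x *\<^sub>R H K)"
    unfolding taylor_poly_def
    using H 0 finite_mi
    by (intro sum.mono_neutral_cong) (auto simp: coeff_space_def)
  also have "\<dots> = (\<Sum>i\<in>UNIV. x $ i *\<^sub>R H (axis i 1))"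
    by (subst sum.reindex) (auto simp: inj_on_def axis_eq_axis monomial_deriv_axis simp del: One_nat_def)
  also have "\<dots> = ?c *v x"
    by (simp add: vec_eq_iff matrix_vector_mult_def ac_simps)
  finally show "taylor_poly n H x = ?c *v x" .
qed

section \<open>Topological preliminaries\<close>

text \<open>Matches the form in which invariance is known: at each point, for nearby points of the
  set. The values of \<open>f\<close> may be truth values, so it also propagates a property along a
  connected set.\<close>

lemma connected_eventually_constant:
  assumes "connected S" and "\<And>a. a \<in> S \<Longrightarrow> \<forall>\<^sub>F x in nhds a. x \<in> S \<longrightarrow> f x = f a"
    and "x \<in> S" "y \<in> S"
  shows "f x = f y"
proof -
  have "f constant_on S"
  proof (rule locally_constant_imp_constant[OF assms(1)])
    fix a assume a: "a \<in> S"
    obtain T where T: "open T" "a \<in> T" "\<And>x. x \<in> T \<Longrightarrow> x \<in> S \<longrightarrow> f x = f a"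
      using assms(2)[OF a] unfolding eventually_nhds by blast
    then show "\<exists>T. openin (top_of_set S) T \<and> a \<in> T \<and> (\<forall>x\<in>T. f x = f a)"
      using openin_open_Int[OF T(1), of S] a T(2,3) by blast
  qed
  then show ?thesis
    using assms(3,4) by (auto simp: constant_on_def)
qed

lemma tendsto_continuous_on_open:
  fixes p :: "'a::t2_space" and f :: "'a \<Rightarrow> 'b::t2_space"
  assumes "continuous_on S f" "open S" "p \<in> S" "(h \<longlongrightarrow> p) F"
  shows "((\<lambda>i. f (h i)) \<longlongrightarrow> f p) F"
  using assms(1-3) by (intro isCont_tendsto_compose[OF _ assms(4)]) (simp add: continuous_on_eq_continuous_at)

text \<open>The coefficient functions carry the product topology, which comes without balls. A basic
  box restricts finitely many coordinates, and shrinking those to balls gives a box that contains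
  the segments between its points.\<close>

lemma open_fun_convex_nhd:
  fixes F :: "'i \<Rightarrow> 'b::real_normed_vector"
  assumes "open C" "F \<in> C"
  obtains C' where "open C'" "F \<in> C'" "C' \<subseteq> C"
    "\<And>G H t. G \<in> C' \<Longrightarrow> H \<in> C' \<Longrightarrow> t \<in> {0..1} \<Longrightarrow> (\<lambda>i. G i + t *\<^sub>R (H i - G i)) \<in> C'"
proof -
  have "openin (product_topology (\<lambda>i. euclidean) UNIV) C"
    using assms(1) by (simp add: open_fun_def)
  from product_topology_open_contains_basis[OF this assms(2)]
  obtain X where X: "F \<in> Pi\<^sub>E UNIV X" "\<And>i. open (X i)" "finite {i. X i \<noteq> UNIV}" "Pi\<^sub>E UNIV X \<subseteq> C"
    by auto
  \<comment> \<open>Unrestricted coordinates stay \<open>UNIV\<close>, so that the product of the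
    chosen sets is still open.\<close>
  have "\<exists>Y. open Y \<and> convex Y \<and> F i \<in> Y \<and> Y \<subseteq> X i \<and> (X i = UNIV \<longrightarrow> Y = UNIV)" for i
  proof (cases "X i = UNIV")
    case False
    obtain r where "r > 0" "ball (F i) r \<subseteq> X i"
      using X(1,2) by (metis PiE_E UNIV_I open_contains_ball)
    then show ?thesis
      using False by (intro exI[of _ "ball (F i) r"]) auto
  qed (auto intro!: exI[of _ UNIV])
  then obtain Y where Y: "\<And>i. open (Y i)" "\<And>i. convex (Y i)" "\<And>i. F i \<in> Y i"
    "\<And>i. Y i \<subseteq> X i" "\<And>i. X i = UNIV \<Longrightarrow> Y i = UNIV"
    by metis
  show ?thesis
  proof
    show "open (Pi\<^sub>E UNIV Y)"
      using Y(5) by (intro open_PiE Y(1) finite_subset[OF _ X(3)]) auto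
    show "F \<in> Pi\<^sub>E UNIV Y"
      using Y(3) by auto
    show "Pi\<^sub>E UNIV Y \<subseteq> C"
      using X(4) Y(4) by (meson PiE_mono order_trans)
    fix G H t assume G: "G \<in> Pi\<^sub>E UNIV Y" and H: "H \<in> Pi\<^sub>E UNIV Y" and t: "t \<in> {0..1::real}"
    have "G i + t *\<^sub>R (H i - G i) \<in> Y i" for i
    proof -
      have "(1 - t) *\<^sub>R G i + t *\<^sub>R H i \<in> Y i"
        using G H t by (intro convexD[OF Y(2)]) auto
      then show ?thesis
        by (simp add: algebra_simps)
    qed
    then show "(\<lambda>i. G i + t *\<^sub>R (H i - G i)) \<in> Pi\<^sub>E UNIV Y"
      by (simp add: PiE_UNIV_domain)
  qed
qed

text \<open>The required function of the higher coordinates evaluates \<open>I\<close> at a chosen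
  jet of \<open>U\<close> with these coordinates.\<close>

lemma depends_only_on_higherI:
  assumes "\<And>z z'. z \<in> U \<Longrightarrow> z' \<in> U \<Longrightarrow> higher_coords z = higher_coords z' \<Longrightarrow> I z = I z'"
  shows "depends_only_on_higher U I"
  unfolding depends_only_on_higher_def
proof (intro exI ballI)
  fix z assume z: "z \<in> U"
  define y where "y = (SOME y. y \<in> U \<and> higher_coords y = higher_coords z)"
  have "z \<in> U \<and> higher_coords z = higher_coords z"
    using z by blast
  then have y: "y \<in> U \<and> higher_coords y = higher_coords z"
    unfolding y_def by (rule someI)
  have "I z = I y"
    by (rule assms) (use y z in simp_all)
  then show "I z = (\<lambda>w. I (SOME y. y \<in> U \<and> higher_coords y = w)) (higher_coords z)"
    unfolding y_def .
qed

lemma depends_only_on_higherD: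
  "depends_only_on_higher U I \<Longrightarrow> z \<in> U \<Longrightarrow> z' \<in> U \<Longrightarrow> higher_coords z = higher_coords z' \<Longrightarrow> I z = I z'"
  unfolding depends_only_on_higher_def by (elim exE) simp

text \<open>Trades a property of group elements close to \<open>e\<close> for one of small
  parameters: each small \<open>s\<close> gets a witness with the property.\<close>

lemma contains_family_eventually:
  assumes "contains_family e D act T" "\<forall>\<^sub>F g in nhds e. P g"
  shows "\<forall>\<^sub>F s in nhds 0. \<exists>g. P g \<and> (\<forall>z. (g, z) \<in> D \<longrightarrow> act g z = T s z)"
proof -
  obtain N where N: "open N" "e \<in> N" "\<And>g. g \<in> N \<Longrightarrow> P g"
    using assms(2) unfolding eventually_nhds by blast
  have "\<forall>\<^sub>F s in nhds 0. \<exists>g\<in>N. \<forall>z. (g, z) \<in> D \<longrightarrow> act g z = T s z"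
    using assms(1) N(1,2) unfolding contains_family_def by blast
  then show ?thesis
    by (rule eventually_mono) (use N(3) in blast)
qed

text \<open>Makes the two neighbourhoods independent, so that one factor may be fixed while the
  other still ranges over a full neighbourhood.\<close>

lemma eventually_nhds_prodE:
  assumes "\<forall>\<^sub>F p in nhds (a, b). P p"
  obtains A B where "\<forall>\<^sub>F x in nhds a. A x" "\<forall>\<^sub>F y in nhds b. B y" "\<And>x y. A x \<Longrightarrow> B y \<Longrightarrow> P (x, y)"
  using assms unfolding nhds_prod eventually_prod_filter by blast

lemma eventually_nhds_minus:
  fixes b :: "'z::real_normed_vector"
  assumes "\<forall>\<^sub>F s in nhds 0. P s"
  shows "\<forall>\<^sub>F b' in nhds b. P (b' - b)"
proof -
  have "((\<lambda>b'. b' - b) \<longlongrightarrow> b - b) (nhds b)"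
    by (intro tendsto_diff filterlim_ident tendsto_const)
  then show ?thesis
    using assms by (simp add: filterlim_iff)
qed

lemma tendsto_projections: "(fst \<longlongrightarrow> a) (nhds (a, b))" "(snd \<longlongrightarrow> b) (nhds (a, b))"
  using tendsto_fst[OF filterlim_ident] tendsto_snd[OF filterlim_ident] by fastforce+

section \<open>Prolonged local actions\<close>

locale local_group_action =
  fixes V \<Lambda> :: "'g::euclidean_space set"
    and \<Omega> :: "('g \<times> 'g) set"
    and e :: 'g
    and mul :: "'g \<Rightarrow> 'g \<Rightarrow> 'g"
    and ginv :: "'g \<Rightarrow> 'g"
    and M :: "((real^'p::finite) \<times> (real^'q::finite)) set"
    and D :: "('g \<times> ((real^'p) \<times> (real^'q))) set"
    and act :: "'g \<Rightarrow> (real^'p) \<times> (real^'q) \<Rightarrow> (real^'p) \<times> (real^'q)"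
  assumes group: "local_lie_group V e \<Omega> mul \<Lambda> ginv"
    and action: "local_action V e \<Omega> mul M D act"
begin

lemma open_domains: "open M" "open D" "open \<Omega>" "open \<Lambda>"
  using group action by (auto simp: local_lie_group_def local_action_def)

lemma D_imp: "(g, z) \<in> D \<Longrightarrow> g \<in> V" "(g, z) \<in> D \<Longrightarrow> z \<in> M"
  using action by (auto simp: local_action_def)

lemma e_simps:
  "e \<in> \<Lambda>" "z \<in> M \<Longrightarrow> (e, z) \<in> D" "z \<in> M \<Longrightarrow> act e z = z"
  "g \<in> V \<Longrightarrow> mul e g = g" "g \<in> V \<Longrightarrow> mul g e = g" "g \<in> V \<Longrightarrow> (e, g) \<in> \<Omega>" "g \<in> V \<Longrightarrow> (g, e) \<in> \<Omega>"
  "e \<in> V"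
  using group action by (auto simp: local_lie_group_def local_action_def)

lemma ginv_simps:
  assumes "g \<in> \<Lambda>"
  shows "g \<in> V" "ginv g \<in> V" "(g, ginv g) \<in> \<Omega>" "(ginv g, g) \<in> \<Omega>" "mul g (ginv g) = e" "mul (ginv g) g = e"
  using group assms by (auto simp: local_lie_group_def)

lemma ginv_e: "ginv e = e"
  using ginv_simps(5)[of e] ginv_simps(2)[of e] by (simp add: e_simps)

lemma act_mul:
  "(h, z) \<in> D \<Longrightarrow> (g, h) \<in> \<Omega> \<Longrightarrow> (g, act h z) \<in> D \<Longrightarrow> (mul g h, z) \<in> D \<Longrightarrow> act (mul g h) z = act g (act h z)"
  using action unfolding local_action_def by metis

lemma continuous_on_ops:
  "continuous_on D (\<lambda>(g, z). act g z)" "continuous_on \<Omega> (\<lambda>(g, h). mul g h)" "continuous_on \<Lambda> ginv"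
  using group action smooth_on_imp_continuous_on by (auto simp: local_lie_group_def local_action_def)

lemma tendsto_act:
  "(a \<longlongrightarrow> g) F \<Longrightarrow> (b \<longlongrightarrow> z) F \<Longrightarrow> (g, z) \<in> D \<Longrightarrow> ((\<lambda>i. act (a i) (b i)) \<longlongrightarrow> act g z) F"
  using tendsto_continuous_on_open[OF continuous_on_ops(1) open_domains(2) _ tendsto_Pair, of g z a F b] by simp

lemma tendsto_mul:
  "(a \<longlongrightarrow> g) F \<Longrightarrow> (b \<longlongrightarrow> h) F \<Longrightarrow> (g, h) \<in> \<Omega> \<Longrightarrow> ((\<lambda>i. mul (a i) (b i)) \<longlongrightarrow> mul g h) F"
  using tendsto_continuous_on_open[OF continuous_on_ops(2) open_domains(3) _ tendsto_Pair, of g h a F b] by simp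

lemma tendsto_ginv:
  "(a \<longlongrightarrow> g) F \<Longrightarrow> g \<in> \<Lambda> \<Longrightarrow> ((\<lambda>i. ginv (a i)) \<longlongrightarrow> ginv g) F"
  by (rule tendsto_continuous_on_open[OF continuous_on_ops(3) open_domains(4)])

lemma eventually_D:
  "(a \<longlongrightarrow> g) F \<Longrightarrow> (b \<longlongrightarrow> z) F \<Longrightarrow> (g, z) \<in> D \<Longrightarrow> \<forall>\<^sub>F i in F. (a i, b i) \<in> D"
  by (rule topological_tendstoD[OF tendsto_Pair open_domains(2)])

lemma eventually_\<Omega>:
  "(a \<longlongrightarrow> g) F \<Longrightarrow> (b \<longlongrightarrow> h) F \<Longrightarrow> (g, h) \<in> \<Omega> \<Longrightarrow> \<forall>\<^sub>F i in F. (a i, b i) \<in> \<Omega>"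
  by (rule topological_tendstoD[OF tendsto_Pair open_domains(3)])

lemma eventually_\<Lambda>:
  "(a \<longlongrightarrow> g) F \<Longrightarrow> g \<in> \<Lambda> \<Longrightarrow> \<forall>\<^sub>F i in F. a i \<in> \<Lambda>"
  by (rule topological_tendstoD[OF _ open_domains(4)])

section \<open>Graphs under restriction, translation and transvection\<close>

lemma act_ginv_act:
  assumes "g \<in> \<Lambda>" "(g, z) \<in> D" "(ginv g, act g z) \<in> D"
  shows "act (ginv g) (act g z) = z"
  using act_mul[OF assms(2) ginv_simps(4)[OF assms(1)] assms(3)] assms
  by (simp add: ginv_simps e_simps D_imp(2)[OF assms(2)])

lemma act_act_ginv:
  assumes "g \<in> \<Lambda>" "(ginv g, z) \<in> D" "(g, act (ginv g) z) \<in> D"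
  shows "act g (act (ginv g) z) = z"
  using act_mul[OF assms(2) ginv_simps(3)[OF assms(1)] assms(3)] assms
  by (simp add: ginv_simps e_simps D_imp(2)[OF assms(2)])

text \<open>The image of a smaller graph is again over an open set, because \<open>ginv g\<close> inverts \<open>g\<close>
  near the point.\<close>

lemma transforms_graph_shrink:
  assumes tg: "transforms_graph D act g A u B v" and g: "g \<in> \<Lambda>" and x: "x \<in> A"
    and inv: "(ginv g, act g (x, u x)) \<in> D" and ev: "\<forall>\<^sub>F z in nhds (x, u x). Q z"
  obtains A' B' where "transforms_graph D act g A' u B' v" "x \<in> A'" "fst (act g (x, u x)) \<in> B'"
    "\<And>\<xi>. \<xi> \<in> A' \<Longrightarrow> Q (\<xi>, u \<xi>)"
proof -
  have A: "open A" "smooth_on A u" "\<And>\<xi>. \<xi> \<in> A \<Longrightarrow> (g, (\<xi>, u \<xi>)) \<in> D" and B: "open B" "smooth_on B v"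
    and im: "(\<lambda>x. act g (x, u x)) ` A = (\<lambda>y. (y, v y)) ` B"
    using tg by (auto simp: transforms_graph_def)
  note u = smooth_on_imp_continuous_on[OF A(2)] and v = smooth_on_imp_continuous_on[OF B(2)]
  obtain N where N: "open N" "(x, u x) \<in> N" "\<And>z. z \<in> N \<Longrightarrow> Q z"
    using ev unfolding eventually_nhds by blast
  have cont_act: "continuous_on A (\<lambda>\<xi>. act g (\<xi>, u \<xi>))"
    using continuous_on_compose2[OF continuous_on_ops(1), of A "\<lambda>\<xi>. (g, (\<xi>, u \<xi>))"] A(3)
    by (force intro!: continuous_intros u)
  \<comment> \<open>The points over which the graph lies in \<open>N\<close>, hence satisfies
    \<open>Q\<close>, and over which its image can be sent back by \<open>ginv g\<close>.\<close>
  define A' where "A' = (A \<inter> (\<lambda>\<xi>. (\<xi>, u \<xi>)) -` N) \<inter> (A \<inter> (\<lambda>\<xi>. (ginv g, act g (\<xi>, u \<xi>))) -` D)"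
  have A'_open: "open A'"
    unfolding A'_def using A(1) N(1) open_domains(2)
    by (intro open_Int continuous_open_preimage continuous_on_Pair continuous_on_const
        continuous_on_id u cont_act)
  define B1 where "B1 = B \<inter> (\<lambda>y. (ginv g, (y, v y))) -` D"
  have B1_open: "open B1"
    unfolding B1_def using B(1) open_domains(2)
    by (intro continuous_open_preimage continuous_on_Pair continuous_on_const continuous_on_id v)
  \<comment> \<open>Recovers the base point of the original graph from that of its image; its
    continuity makes \<open>B'\<close> open.\<close>
  define \<psi> where "\<psi> = (\<lambda>y. fst (act (ginv g) (y, v y)))"
  have "continuous_on B1 (\<lambda>y. (ginv g, (y, v y)))"
    using v by (intro continuous_on_Pair continuous_on_const continuous_on_id)
      (auto simp: B1_def intro: continuous_on_subset)
  then have "continuous_on B1 (\<lambda>y. act (ginv g) (y, v y))"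
    using continuous_on_compose2[OF continuous_on_ops(1), of B1 "\<lambda>y. (ginv g, (y, v y))"]
    by (force simp: B1_def)
  then have \<psi>_cont: "continuous_on B1 \<psi>"
    unfolding \<psi>_def by (rule continuous_on_fst)
  define B' where "B' = B1 \<inter> \<psi> -` A'"
  have B'_open: "open B'"
    unfolding B'_def by (intro continuous_open_preimage \<psi>_cont B1_open A'_open)
  have \<psi>: "y \<in> B1 \<and> \<psi> y = \<xi>" if "\<xi> \<in> A" "y \<in> B" "act g (\<xi>, u \<xi>) = (y, v y)" "(ginv g, (y, v y)) \<in> D" for \<xi> y
    using act_ginv_act[OF g A(3)[OF that(1)]] that by (simp add: B1_def \<psi>_def)
  have sub: "act g (\<xi>, u \<xi>) \<in> (\<lambda>y. (y, v y)) ` B'" if \<xi>: "\<xi> \<in> A'" for \<xi>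
  proof -
    have "\<xi> \<in> A" "(ginv g, act g (\<xi>, u \<xi>)) \<in> D"
      using \<xi> by (auto simp: A'_def)
    moreover obtain y where "y \<in> B" "act g (\<xi>, u \<xi>) = (y, v y)"
      using im \<open>\<xi> \<in> A\<close> by blast
    ultimately have "y \<in> B'"
      using \<psi>[of \<xi> y] \<xi> by (simp add: B'_def)
    with \<open>act g (\<xi>, u \<xi>) = (y, v y)\<close> show ?thesis by blast
  qed
  have x': "x \<in> A'"
    using x inv N(2) by (simp add: A'_def)
  show ?thesis
  proof
    have "(y, v y) \<in> (\<lambda>x. act g (x, u x)) ` A'" if y: "y \<in> B'" for y
    proof -
      have yB: "y \<in> B" "(ginv g, (y, v y)) \<in> D" "\<psi> y \<in> A'"
        using y by (auto simp: B'_def B1_def)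
      then obtain \<xi> where "\<xi> \<in> A" "act g (\<xi>, u \<xi>) = (y, v y)"
        using im by (metis (no_types, lifting) imageE imageI)
      with \<psi>[of \<xi> y] yB show ?thesis by force
    qed
    with sub have "(\<lambda>x. act g (x, u x)) ` A' = (\<lambda>y. (y, v y)) ` B'" by blast
    moreover have "A' \<subseteq> A" "B' \<subseteq> B"
      by (auto simp: A'_def B'_def B1_def)
    ultimately show "transforms_graph D act g A' u B' v"
      unfolding transforms_graph_def
      using A(3) A'_open B'_open smooth_on_subset[OF A(2)] smooth_on_subset[OF B(2)] by blast
    show "x \<in> A'" by (fact x')
    show "fst (act g (x, u x)) \<in> B'"
      using sub[OF x'] by auto
    show "Q (\<xi>, u \<xi>)" if "\<xi> \<in> A'" for \<xi>
      using that N(3) by (simp add: A'_def)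
  qed
qed

lemma prolonged_action_imp:
  assumes "prolonged_action D act n g (b, F) (b', F')"
  shows "(g, b) \<in> D" "act g b = b'"
  using assms by (auto simp: prolonged_action_def transforms_graph_def jet_of_def)

text \<open>Moving the source graph by \<open>s\<close> and its image by \<open>s'\<close> turns a
  graph carried by \<open>g\<close> into one carried by \<open>h\<close>, and translations leave
  Taylor coefficients alone. As \<open>h\<close> is compared with \<open>g\<close> only near
  \<open>b\<close>, the graph is shrunk first. The lemma is applied to a translation compared with
  \<open>e\<close>, to a translation after \<open>g\<close>, and to a conjugate of
  \<open>g\<close>.\<close>

lemma prolonged_action_shift:
  assumes pr: "prolonged_action D act n g (b, F) (b', F')" and g: "g \<in> \<Lambda>" and inv: "(ginv g, act g b) \<in> D"
    and ev: "\<forall>\<^sub>F z in nhds b. (h, z + s) \<in> D \<and> act h (z + s) = act g z + s'"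
  shows "prolonged_action D act n h (b + s, F) (b' + s', F')"
proof -
  obtain A u B v x y where tg: "transforms_graph D act g A u B v" and xy: "x \<in> A" "y \<in> B"
    "act g (x, u x) = (y, v y)" and b: "b = (x, u x)" "F = taylor_coeffs n u x"
    "b' = (y, v y)" "F' = taylor_coeffs n v y"
    using pr unfolding prolonged_action_def jet_of_def by blast
  obtain A' B' where tg': "transforms_graph D act g A' u B' v" and xy': "x \<in> A'" "fst (act g (x, u x)) \<in> B'"
    and Q: "\<And>\<xi>. \<xi> \<in> A' \<Longrightarrow> (h, (\<xi>, u \<xi>) + s) \<in> D \<and> act h ((\<xi>, u \<xi>) + s) = act g (\<xi>, u \<xi>) + s'"
    using transforms_graph_shrink[OF tg g xy(1) inv[unfolded b] ev[unfolded b]] by blast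
  have t: "open A'" "smooth_on A' u" "open B'" "smooth_on B' v"
    "(\<lambda>x. act g (x, u x)) ` A' = (\<lambda>y. (y, v y)) ` B'"
    using tg' by (auto simp: transforms_graph_def)
  have pair: "(\<xi> + fst r, graph_shift r w (\<xi> + fst r)) = (\<xi>, w \<xi>) + r"
    for \<xi> r and w :: "real^'p \<Rightarrow> real^'q"
    by (simp add: graph_shift_def prod_eq_iff)
  have op: "open ((\<lambda>x. x + a) ` S)" if "open S" for S :: "(real^'p) set" and a
    using open_translation[OF that, of a] by (simp add: add.commute)
  have "(\<lambda>x. act h (x, graph_shift s u x)) ` (\<lambda>x. x + fst s) ` A' =
      (\<lambda>z. z + s') ` (\<lambda>x. act g (x, u x)) ` A'"
    unfolding image_image pair using Q by (intro image_cong) auto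
  also have "\<dots> = (\<lambda>y. (y, graph_shift s' v y)) ` (\<lambda>x. x + fst s') ` B'"
    unfolding t(5) unfolding image_image pair ..
  finally have "transforms_graph D act h ((\<lambda>x. x + fst s) ` A') (graph_shift s u)
      ((\<lambda>x. x + fst s') ` B') (graph_shift s' v)"
    unfolding transforms_graph_def using t Q
    by (auto simp: smooth_on_graph_shift op pair simp del: image_image)
  moreover have "x + fst s \<in> (\<lambda>x. x + fst s) ` A'" "y + fst s' \<in> (\<lambda>x. x + fst s') ` B'"
    using xy xy' by auto
  moreover have "act h (x + fst s, graph_shift s u (x + fst s)) = (y + fst s', graph_shift s' v (y + fst s'))"
    unfolding pair using Q[OF xy'(1)] xy(3) by simp
  moreover have "(b + s, F) = jet_of n (graph_shift s u) (x + fst s)"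
    "(b' + s', F') = jet_of n (graph_shift s' v) (y + fst s')"
    unfolding jet_of_shift b by simp_all
  ultimately show ?thesis
    unfolding prolonged_action_def by blast
qed

text \<open>A transvection fixes \<open>x\<close>, so both graphs lie over the same set and it
  suffices to compare the two translated Taylor polynomials pointwise, which is the hypothesis
  \<open>eq\<close>. Setting \<open>c\<close> to 0 gives the identity.\<close>

lemma prolonged_action_transvection:
  assumes "(g, b) \<in> D" and g: "\<And>z. (g, z) \<in> D \<Longrightarrow> act g z = transvection c z"
    and F: "F \<in> coeff_space n" "G \<in> coeff_space n" and b': "fst b' = fst b"
    and eq: "\<And>x. graph_shift b' (taylor_poly n G) x = graph_shift b (taylor_poly n F) x + c *v x"
  shows "prolonged_action D act n g (b, F) (b', G)"
proof -
  let ?u = "graph_shift b (taylor_poly n F)" and ?v = "graph_shift b' (taylor_poly n G)"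
  \<comment> \<open>The part of the base over which \<open>g\<close> acts on the graph; it also
    serves as the domain of the image.\<close>
  define A where "A = UNIV \<inter> (\<lambda>x. (g, (x, ?u x))) -` D"
  have "continuous_on UNIV ?u"
    by (intro smooth_on_imp_continuous_on smooth_graph_shift_taylor_poly)
  then have "open A"
    unfolding A_def
    by (intro continuous_open_preimage continuous_on_Pair continuous_on_const continuous_on_id
        open_UNIV open_domains(2))
  have act: "act g (x, ?u x) = (x, ?v x)" if "x \<in> A" for x
    using that g[of "(x, ?u x)"] by (simp add: A_def transvection_def eq)
  have "transforms_graph D act g A ?u A ?v"
    unfolding transforms_graph_def
    using \<open>open A\<close> act by (auto simp: smooth_graph_shift_taylor_poly A_def)
  moreover have "(fst b, ?u (fst b)) = b"
    by (simp add: graph_shift_def taylor_poly_0)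
  then have "fst b \<in> A"
    using assms(1) by (simp add: A_def)
  ultimately show ?thesis
    unfolding prolonged_action_def
    using act[of "fst b"] jet_of_taylor_poly[OF F(1), of b] jet_of_taylor_poly[OF F(2), of b']
    by (metis b')
qed

lemma prolonged_action_e:
  assumes "b \<in> M" "F \<in> coeff_space n"
  shows "prolonged_action D act n e (b, F) (b, F)"
  using assms e_simps D_imp
  by (intro prolonged_action_transvection[where c = 0]) (auto simp: transvection_def)

end

section \<open>Invariants of groups containing translations and transvections\<close>

locale translation_transvection_action = local_group_action V \<Lambda> \<Omega> e mul ginv M D act
  for V \<Lambda> :: "'g::euclidean_space set" and \<Omega> e mul ginv
    and M :: "((real^'p::finite) \<times> (real^'q::finite)) set" and D act +
  assumes origin: "0 \<in> M"
    and contains_translations: "contains_family e D act translation"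
    and contains_transvections: "contains_family e D act transvection"
begin

section \<open>Local constancy of differential invariants\<close>

lemma jet_domain:
  assumes "openin (top_of_set (jet_space M n)) U" "(b, F) \<in> U"
  shows "b \<in> M" "F \<in> coeff_space n"
  using openin_imp_subset[OF assms(1)] assms(2) by (auto simp: jet_space_def)

lemma invariantD:
  "I \<in> differential_invariants e D act n U \<Longrightarrow> z \<in> U \<Longrightarrow>
    \<forall>\<^sub>F g in nhds e. \<forall>z'\<in>U. prolonged_action D act n g z z' \<longrightarrow> I z' = I z"
  unfolding differential_invariants_def by simp

lemma translation_invariant:
  assumes U: "openin (top_of_set (jet_space M n)) U" and I: "I \<in> differential_invariants e D act n U"
    and b: "(b, F) \<in> U"
  shows "\<forall>\<^sub>F b' in nhds b. (b', F) \<in> U \<longrightarrow> I (b', F) = I (b, F)"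
proof -
  have M: "b \<in> M" "F \<in> coeff_space n"
    using jet_domain[OF U b] by auto
  have "\<forall>\<^sub>F g in nhds e. (g, b) \<in> D"
    using M by (intro eventually_D[OF filterlim_ident tendsto_const]) (simp add: e_simps)
  with invariantD[OF I b]
  have "\<forall>\<^sub>F g in nhds e. (\<forall>z'\<in>U. prolonged_action D act n g (b, F) z' \<longrightarrow> I z' = I (b, F)) \<and> (g, b) \<in> D"
    by (rule eventually_conj)
  from eventually_nhds_minus[OF contains_family_eventually[OF contains_translations this]]
  show ?thesis
  proof (rule eventually_mono, intro impI)
    fix b' assume "\<exists>g. ((\<forall>z'\<in>U. prolonged_action D act n g (b, F) z' \<longrightarrow> I z' = I (b, F)) \<and> (g, b) \<in> D) \<and>
        (\<forall>z. (g, z) \<in> D \<longrightarrow> act g z = translation (b' - b) z)" and b': "(b', F) \<in> U"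
    then obtain g where g: "\<And>z'. z' \<in> U \<Longrightarrow> prolonged_action D act n g (b, F) z' \<Longrightarrow> I z' = I (b, F)"
      "(g, b) \<in> D" "\<And>z. (g, z) \<in> D \<Longrightarrow> act g z = z + (b' - b)"
      unfolding translation_def by blast
    have "\<forall>\<^sub>F z in nhds b. z \<in> M"
      using M open_domains(1) eventually_nhds by blast
    moreover have "\<forall>\<^sub>F z in nhds b. (g, z) \<in> D"
      using g(2) by (rule eventually_D[OF tendsto_const filterlim_ident])
    \<comment> \<open>Compares \<open>g\<close> with the identity: no shift in the source, a shift
      by \<open>b' - b\<close> in the target.\<close>
    ultimately have "\<forall>\<^sub>F z in nhds b. (g, z + 0) \<in> D \<and> act g (z + 0) = act e z + (b' - b)"
      by eventually_elim (simp add: g(3) e_simps)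
    from prolonged_action_shift[OF prolonged_action_e[OF M] _ _ this]
    have "prolonged_action D act n g (b + 0, F) (b + (b' - b), F)"
      using M by (simp add: e_simps ginv_e)
    then show "I (b', F) = I (b, F)"
      using g(1)[OF b'] by simp
  qed
qed

lemma invariant_const_on_fibre:
  assumes U: "openin (top_of_set (jet_space M n)) U" and I: "I \<in> differential_invariants e D act n U"
    and S: "connected S" "\<And>b. b \<in> S \<Longrightarrow> (b, F) \<in> U" and b: "b \<in> S" "b' \<in> S"
  shows "I (b, F) = I (b', F)"
proof (rule connected_eventually_constant[OF S(1) _ b])
  fix a assume "a \<in> S"
  show "\<forall>\<^sub>F x in nhds a. x \<in> S \<longrightarrow> I (x, F) = I (a, F)"
    using translation_invariant[OF U I S(2)[OF \<open>a \<in> S\<close>]]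
    by (rule eventually_mono) (use S(2) in blast)
qed

text \<open>The transvection with matrix \<open>(t - t0) *\<^sub>R c\<close> realizes the motion of
  the coefficients along the line through \<open>F\<close> in direction \<open>H\<close>. It also
  lifts the point over \<open>fst b\<close>, so the base point has to move with
  \<open>t\<close>.\<close>

lemma transvection_invariant:
  fixes H :: "('p, 'q) coeffs"
  assumes U: "openin (top_of_set (jet_space M n)) U" and I: "I \<in> differential_invariants e D act n U"
    and b: "(b, \<lambda>J. F J + t0 *\<^sub>R H J) \<in> U" and F: "F \<in> coeff_space n"
    and H: "H \<in> coeff_space n" and c: "\<And>x. taylor_poly n H x = c *v x"
  shows "\<forall>\<^sub>F t in nhds t0. ((fst b, snd b + (t - t0) *\<^sub>R (c *v fst b)), \<lambda>J. F J + t *\<^sub>R H J) \<in> U \<longrightarrow>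
    I ((fst b, snd b + (t - t0) *\<^sub>R (c *v fst b)), \<lambda>J. F J + t *\<^sub>R H J) = I (b, \<lambda>J. F J + t0 *\<^sub>R H J)"
proof -
  let ?F = "\<lambda>t J. F J + t *\<^sub>R H J" and ?b = "\<lambda>t. (fst b, snd b + (t - t0) *\<^sub>R (c *v fst b))"
  have M: "b \<in> M"
    using jet_domain[OF U b] by auto
  have coeff: "?F t \<in> coeff_space n" for t
    using F H by (auto simp: coeff_space_def)
  have "\<forall>\<^sub>F g in nhds e. (g, b) \<in> D"
    using M by (intro eventually_D[OF filterlim_ident tendsto_const]) (simp add: e_simps)
  with invariantD[OF I b]
  have "\<forall>\<^sub>F g in nhds e. (\<forall>z'\<in>U. prolonged_action D act n g (b, ?F t0) z' \<longrightarrow> I z' = I (b, ?F t0)) \<and> (g, b) \<in> D"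
    by (rule eventually_conj)
  note ev = contains_family_eventually[OF contains_transvections this]
  have "((\<lambda>t. (t - t0) *\<^sub>R c) \<longlongrightarrow> (t0 - t0) *\<^sub>R c) (nhds t0)"
    by (intro tendsto_scaleR tendsto_diff filterlim_ident tendsto_const)
  then have "filterlim (\<lambda>t. (t - t0) *\<^sub>R c) (nhds 0) (nhds t0)"
    by simp
  from eventually_compose_filterlim[OF ev this]
  show ?thesis
  proof (rule eventually_mono, intro impI)
    fix t assume "\<exists>g. ((\<forall>z'\<in>U. prolonged_action D act n g (b, ?F t0) z' \<longrightarrow> I z' = I (b, ?F t0)) \<and> (g, b) \<in> D) \<and>
        (\<forall>z. (g, z) \<in> D \<longrightarrow> act g z = transvection ((t - t0) *\<^sub>R c) z)" and bt: "(?b t, ?F t) \<in> U"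
    then obtain g where g: "\<And>z'. z' \<in> U \<Longrightarrow> prolonged_action D act n g (b, ?F t0) z' \<Longrightarrow> I z' = I (b, ?F t0)"
      "(g, b) \<in> D" "\<And>z. (g, z) \<in> D \<Longrightarrow> act g z = transvection ((t - t0) *\<^sub>R c) z"
      by blast
    \<comment> \<open>The polynomial is centred at \<open>fst b\<close>, so it changes by
      \<open>t - t0\<close> times \<open>c *v (x - fst b)\<close>; the lift of the base point
      supplies the missing multiple of \<open>c *v fst b\<close>.\<close>
    have "graph_shift (?b t) (taylor_poly n (?F t)) x = graph_shift b (taylor_poly n (?F t0)) x + ((t - t0) *\<^sub>R c) *v x" for x
      unfolding graph_shift_def taylor_poly_add_scaleR c
      by (simp add: algebra_simps matrix_vector_mult_diff_distrib scaleR_matrix_vector_assoc[symmetric])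
    then have "prolonged_action D act n g (b, ?F t0) (?b t, ?F t)"
      by (intro prolonged_action_transvection[OF g(2,3) coeff coeff]) simp_all
    then show "I (?b t, ?F t) = I (b, ?F t0)"
      by (rule g(1)[OF bt])
  qed
qed

text \<open>On a ball times a convex box, translations identify all base points, and jets with equal
  higher coordinates are joined by a segment of coefficients. The vertical drift caused by the
  transvections is undone by translating back inside the ball.\<close>

lemma invariant_locally_higher:
  assumes U: "openin (top_of_set (jet_space M n)) U" and I: "I \<in> differential_invariants e D act n U"
    and z: "z \<in> U"
  shows "\<exists>U'. openin (top_of_set U) U' \<and> z \<in> U' \<and> depends_only_on_higher U' I"
proof -
  obtain W where W: "open W" "U = jet_space M n \<inter> W"
    using U unfolding openin_open by blast
  obtain b0 F0 where z0: "z = (b0, F0)" by (cases z)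
  have "z \<in> W" using z W by blast
  obtain B C where BC: "open B" "open C" "z \<in> B \<times> C" "B \<times> C \<subseteq> W"
    using open_prod_elim[OF W(1) \<open>z \<in> W\<close>] by blast
  have b0: "b0 \<in> M" "b0 \<in> B" "F0 \<in> C" "F0 \<in> coeff_space n"
    using jet_domain[OF U z[unfolded z0]] BC(3) z0 by auto
  obtain r where r: "r > 0" "ball b0 r \<subseteq> M \<inter> B"
    using open_contains_ball[of "M \<inter> B"] open_Int[OF open_domains(1) BC(1)] b0 by blast
  obtain C' where C': "open C'" "F0 \<in> C'" "C' \<subseteq> C"
    and seg: "\<And>G H t. G \<in> C' \<Longrightarrow> H \<in> C' \<Longrightarrow> t \<in> {0..1} \<Longrightarrow> (\<lambda>i. G i + t *\<^sub>R (H i - G i)) \<in> C'"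
    using open_fun_convex_nhd[OF BC(2) b0(3)] by blast
  have inU: "(b, F) \<in> U" if "b \<in> ball b0 r" "F \<in> C'" "F \<in> coeff_space n" for b F
  proof -
    have "b \<in> M" "b \<in> B" "F \<in> C"
      using that r(2) C'(3) by auto
    then show ?thesis
      using that(3) BC(4) W(2) by (auto simp: jet_space_def)
  qed
  have fibre: "I (b, F) = I (b', F)" if "b \<in> ball b0 r" "b' \<in> ball b0 r" "F \<in> C'" "F \<in> coeff_space n" for b b' F
    by (rule invariant_const_on_fibre[OF U I convex_connected[OF convex_ball] _ that(1,2)])
      (rule inU[OF _ that(3,4)])
  have high: "I (b0, F) = I (b0, G)"
    if F: "F \<in> C'" "F \<in> coeff_space n" and G: "G \<in> C'" "G \<in> coeff_space n"
      and eq: "\<And>J. 2 \<le> mi_size J \<Longrightarrow> F J = G J" for F G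
  proof -
    define H where "H = (\<lambda>J. G J - F J)"
    let ?F = "\<lambda>t J. F J + t *\<^sub>R H J"
    have H: "H \<in> coeff_space n"
      using F(2) G(2) by (simp add: H_def coeff_space_def)
    obtain c where c: "\<And>x. taylor_poly n H x = c *v x"
      using taylor_poly_first_order[OF H] eq by (auto simp: H_def)
    have FC: "?F t \<in> C'" if "t \<in> {0..1}" for t
      using seg[OF F(1) G(1) that] by (simp add: H_def)
    have Fc: "?F t \<in> coeff_space n" for t
      using F(2) H by (simp add: coeff_space_def)
    have b0r: "b0 \<in> ball b0 r"
      using r(1) by simp
    \<comment> \<open>The base point is held at \<open>b0\<close>, so local constancy in the single
      parameter \<open>t\<close> suffices.\<close>
    have "I (b0, ?F 0) = I (b0, ?F 1)"
    proof (rule connected_eventually_constant[where S = "{0..1::real}" and f = "\<lambda>t. I (b0, ?F t)"])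
      fix t0 :: real assume t0: "t0 \<in> {0..1}"
      let ?b = "\<lambda>t. (fst b0, snd b0 + (t - t0) *\<^sub>R (c *v fst b0))"
      have "(?b \<longlongrightarrow> ?b t0) (nhds t0)"
        by (intro tendsto_Pair tendsto_add tendsto_scaleR tendsto_diff filterlim_ident tendsto_const)
      then have "(?b \<longlongrightarrow> b0) (nhds t0)"
        by simp
      then have "\<forall>\<^sub>F t in nhds t0. ?b t \<in> ball b0 r"
        by (rule topological_tendstoD[OF _ open_ball b0r])
      moreover note transvection_invariant[OF U I inU[OF b0r FC[OF t0] Fc] F(2) H c]
      ultimately show "\<forall>\<^sub>F t in nhds t0. t \<in> {0..1} \<longrightarrow> I (b0, ?F t) = I (b0, ?F t0)"
      proof (rule eventually_elim2, intro impI)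
        fix t assume bt: "?b t \<in> ball b0 r"
          and I: "(?b t, ?F t) \<in> U \<longrightarrow> I (?b t, ?F t) = I (b0, ?F t0)" and t: "t \<in> {0..1}"
        have "I (b0, ?F t) = I (?b t, ?F t)"
          by (rule fibre[OF b0r bt FC[OF t] Fc])
        also have "\<dots> = I (b0, ?F t0)"
          using I inU[OF bt FC[OF t] Fc] by blast
        finally show "I (b0, ?F t) = I (b0, ?F t0)" .
      qed
    qed auto
    then show ?thesis
      by (simp add: H_def)
  qed
  define U' where "U' = U \<inter> (ball b0 r \<times> C')"
  show ?thesis
  proof (intro exI conjI)
    show "openin (top_of_set U) U'"
      unfolding U'_def by (intro openin_open_Int open_Times open_ball C'(1))
    show "z \<in> U'"
      using z z0 r(1) C'(2) by (simp add: U'_def)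
    show "depends_only_on_higher U' I"
    proof (rule depends_only_on_higherI)
      fix y y' assume y: "y \<in> U'" "y' \<in> U'" and eq: "higher_coords y = higher_coords y'"
      obtain b F b' F' where bF: "y = (b, F)" "y' = (b', F')"
        by (cases y, cases y')
      have b: "b \<in> ball b0 r" "b' \<in> ball b0 r" "F \<in> C'" "F' \<in> C'" "(b, F) \<in> U" "(b', F') \<in> U"
        using y by (auto simp: bF U'_def)
      have F: "F \<in> coeff_space n" "F' \<in> coeff_space n"
        using jet_domain[OF U] b by auto
      have b0r: "b0 \<in> ball b0 r"
        using r(1) by simp
      have "F J = F' J" if "2 \<le> mi_size J" for J
        using fun_cong[OF eq, of J] that by (simp add: higher_coords_def bF)
      then have "I (b0, F) = I (b0, F')"
        by (intro high b F)
      then show "I y = I y'"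
        using fibre[OF b(1) b0r b(3) F(1)] fibre[OF b(2) b0r b(4) F(2)] by (simp add: bF)
    qed
  qed
qed

text \<open>Local dependence on the higher coordinates is local constancy on each fibre of
  \<open>higher_coords\<close>, so a connected fibre carries one value.\<close>

lemma invariant_globally_higher:
  assumes U: "openin (top_of_set (jet_space M n)) U" and I: "I \<in> differential_invariants e D act n U"
    and conn: "\<And>w. connected {z \<in> U. higher_coords z = w}"
  shows "depends_only_on_higher U I"
proof (rule depends_only_on_higherI)
  fix y y' assume y: "y \<in> U" "y' \<in> U" "higher_coords y = higher_coords y'"
  let ?S = "{z \<in> U. higher_coords z = higher_coords y}"
  show "I y = I y'"
  proof (rule connected_eventually_constant[OF conn[of "higher_coords y"]])
    fix a assume a: "a \<in> ?S"
    then obtain U' where U': "openin (top_of_set U) U'" "a \<in> U'" "depends_only_on_higher U' I"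
      using invariant_locally_higher[OF U I] by blast
    then obtain T where T: "open T" "U' = U \<inter> T"
      unfolding openin_open by blast
    have "\<forall>\<^sub>F x in nhds a. x \<in> T"
      using T U'(2) by (intro eventually_nhds_in_open) auto
    then show "\<forall>\<^sub>F x in nhds a. x \<in> ?S \<longrightarrow> I x = I a"
    proof (rule eventually_mono, intro impI)
      fix x assume "x \<in> T" "x \<in> ?S"
      then show "I x = I a"
        using a T(2) U'(2) by (intro depends_only_on_higherD[OF U'(3)]) auto
    qed
  qed (use y in auto)
qed

section \<open>Invariance carried between base points\<close>

lemma invariance_local:
  assumes "b0 \<in> M"
  obtains N where "open N" "b0 \<in> N"
    "\<And>b1 b2. b1 \<in> N \<Longrightarrow> b2 \<in> N \<Longrightarrow>
      \<forall>\<^sub>F h in nhds e. \<forall>b' F'. prolonged_action D act n h (b1, F) (b', F') \<longrightarrow> R F' \<Longrightarrow>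
      \<forall>\<^sub>F g in nhds e. \<forall>b' F'. prolonged_action D act n g (b2, F) (b', F') \<longrightarrow> R F'"
proof -
  note lim = tendsto_projections
  note e_b0 = e_simps(2)[OF assms]
  have "\<forall>\<^sub>F p in nhds (e, b0). fst p \<in> \<Lambda> \<and> p \<in> D \<and> (ginv (fst p), snd p) \<in> D \<and>
      (fst p, act (ginv (fst p)) (snd p)) \<in> D"
  proof (intro eventually_conj)
    have g: "((\<lambda>p. ginv (fst p)) \<longlongrightarrow> e) (nhds (e, b0))"
      using tendsto_ginv[OF lim(1) e_simps(1)] by (simp add: ginv_e)
    show "\<forall>\<^sub>F p in nhds (e, b0). fst p \<in> \<Lambda>"
      by (rule eventually_\<Lambda>[OF lim(1) e_simps(1)])
    show "\<forall>\<^sub>F p in nhds (e, b0). p \<in> D"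
      using eventually_D[OF lim e_b0] by simp
    show "\<forall>\<^sub>F p in nhds (e, b0). (ginv (fst p), snd p) \<in> D"
      by (rule eventually_D[OF g lim(2) e_b0])
    show "\<forall>\<^sub>F p in nhds (e, b0). (fst p, act (ginv (fst p)) (snd p)) \<in> D"
      using eventually_D[OF lim(1) tendsto_act[OF g lim(2) e_b0]] assms by (simp add: e_simps)
  qed
  \<comment> \<open>Splitting the joint condition fixes the neighbourhood of \<open>b0\<close>
    before \<open>t\<close> is chosen, so that any two of its points can be related by an admissible
    translation.\<close>
  then obtain Pt Pz where Pt: "\<forall>\<^sub>F t in nhds e. Pt t" and Pz: "\<forall>\<^sub>F z in nhds b0. Pz z"
    and P: "\<And>t z. Pt t \<Longrightarrow> Pz z \<Longrightarrow> t \<in> \<Lambda> \<and> (t, z) \<in> D \<and> (ginv t, z) \<in> D \<and> (t, act (ginv t) z) \<in> D"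
    by (rule eventually_nhds_prodE) auto
  obtain \<delta> where \<delta>: "\<delta> > 0" "\<And>s. dist s 0 < \<delta> \<Longrightarrow> \<exists>t. Pt t \<and> (\<forall>z. (t, z) \<in> D \<longrightarrow> act t z = translation s z)"
    using contains_family_eventually[OF contains_translations Pt] unfolding eventually_nhds_metric by blast
  obtain \<epsilon> where \<epsilon>: "\<epsilon> > 0" "\<And>z. dist z b0 < \<epsilon> \<Longrightarrow> Pz z"
    using Pz unfolding eventually_nhds_metric by blast
  show ?thesis
  proof
    \<comment> \<open>Radius \<open>\<delta> / 2\<close> keeps any two points less than
      \<open>\<delta>\<close> apart, so their difference is an available translation;
      \<open>\<epsilon>\<close> ensures \<open>Pz\<close>.\<close>
    show "open (ball b0 (min \<epsilon> (\<delta> / 2)))" "b0 \<in> ball b0 (min \<epsilon> (\<delta> / 2))"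
      using \<delta>(1) \<epsilon>(1) by simp_all
    fix b1 b2
    assume b12: "b1 \<in> ball b0 (min \<epsilon> (\<delta> / 2))" "b2 \<in> ball b0 (min \<epsilon> (\<delta> / 2))"
      and b1: "\<forall>\<^sub>F h in nhds e. \<forall>b' F'. prolonged_action D act n h (b1, F) (b', F') \<longrightarrow> R F'"
    have z: "Pz b1" "Pz b2"
      using b12 by (auto intro!: \<epsilon>(2) simp: dist_commute)
    have "dist b1 b2 < \<delta>"
      using b12 dist_triangle_half_l[of b1 b0 \<delta> b2] by (auto simp: dist_commute)
    then obtain t where t: "Pt t" "\<And>z. (t, z) \<in> D \<Longrightarrow> act t z = z + (b1 - b2)"
      using \<delta>(2)[of "b1 - b2"] unfolding translation_def dist_norm by auto
    have t\<Lambda>: "t \<in> \<Lambda>" and tD: "(t, b2) \<in> D" "(ginv t, b1) \<in> D" "(t, act (ginv t) b1) \<in> D"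
      using P[OF t(1)] z by auto
    note ti = ginv_simps[OF t\<Lambda>]
    have b2: "act (ginv t) b1 = b2"
      using t(2)[OF tD(3)] act_act_ginv[OF t\<Lambda> tD(2,3)] by (simp add: algebra_simps)
    have M: "b1 \<in> M" "b2 \<in> M"
      using D_imp(2) tD by blast+
    \<comment> \<open>conjugation by \<open>t\<close>; \<open>ginv t\<close> is needed because the translation by \<open>b2 - b1\<close> may come from
      another group element, for which \<open>\<kappa> e = e\<close> can fail if the action is not effective\<close>
    define \<kappa> where "\<kappa> = (\<lambda>g. mul t (mul g (ginv t)))"
    have \<Omega>: "(e, ginv t) \<in> \<Omega>" "(t, mul e (ginv t)) \<in> \<Omega>"
      using ti by (simp_all add: e_simps)
    have \<kappa>_lim: "((\<lambda>i. \<kappa> (a i)) \<longlongrightarrow> e) X" if a: "(a \<longlongrightarrow> e) X" for a and X :: "'c filter"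
      using tendsto_mul[OF tendsto_const tendsto_mul[OF a tendsto_const \<Omega>(1)] \<Omega>(2)] ti
      by (simp add: \<kappa>_def e_simps)
    have mul_lim: "((\<lambda>i. mul (a i) (ginv t)) \<longlongrightarrow> ginv t) X" if a: "(a \<longlongrightarrow> e) X" for a and X :: "'c filter"
      using tendsto_mul[OF a tendsto_const \<Omega>(1)] ti by (simp add: e_simps)
    have "\<forall>\<^sub>F p in nhds (e, b1). (ginv t, snd p) \<in> D \<and> (t, act (ginv t) (snd p)) \<in> D \<and>
        (fst p, act (ginv t) (snd p)) \<in> D \<and> (mul (fst p) (ginv t), snd p) \<in> D \<and>
        (t, act (mul (fst p) (ginv t)) (snd p)) \<in> D \<and> (\<kappa> (fst p), snd p) \<in> D"
    proof (intro eventually_conj)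
      have l1: "((\<lambda>p. act (ginv t) (snd p)) \<longlongrightarrow> b2) (nhds (e, b1))"
        using tendsto_act[OF tendsto_const lim(2) tD(2)] by (simp add: b2)
      have l2: "((\<lambda>p. act (mul (fst p) (ginv t)) (snd p)) \<longlongrightarrow> b2) (nhds (e, b1))"
        using tendsto_act[OF mul_lim[OF lim(1)] lim(2) tD(2)] by (simp add: b2)
      show "\<forall>\<^sub>F p in nhds (e, b1). (ginv t, snd p) \<in> D"
        by (rule eventually_D[OF tendsto_const lim(2) tD(2)])
      show "\<forall>\<^sub>F p in nhds (e, b1). (t, act (ginv t) (snd p)) \<in> D"
        by (rule eventually_D[OF tendsto_const l1 tD(1)])
      show "\<forall>\<^sub>F p in nhds (e, b1). (fst p, act (ginv t) (snd p)) \<in> D"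
        by (rule eventually_D[OF lim(1) l1 e_simps(2)[OF M(2)]])
      show "\<forall>\<^sub>F p in nhds (e, b1). (mul (fst p) (ginv t), snd p) \<in> D"
        by (rule eventually_D[OF mul_lim[OF lim(1)] lim(2) tD(2)])
      show "\<forall>\<^sub>F p in nhds (e, b1). (t, act (mul (fst p) (ginv t)) (snd p)) \<in> D"
        by (rule eventually_D[OF tendsto_const l2 tD(1)])
      show "\<forall>\<^sub>F p in nhds (e, b1). (\<kappa> (fst p), snd p) \<in> D"
        by (rule eventually_D[OF \<kappa>_lim[OF lim(1)] lim(2) e_simps(2)[OF M(1)]])
    qed
    \<comment> \<open>The compositions making up \<kappa> must be defined for one fixed
      \<open>g\<close> at all points near \<open>b1\<close>, since prolongation depends on the
      action near a point.\<close>
    then obtain Pg Pb where Pg: "\<forall>\<^sub>F g in nhds e. Pg g" and Pb: "\<forall>\<^sub>F z in nhds b1. Pb z"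
      and PD: "\<And>g z. Pg g \<Longrightarrow> Pb z \<Longrightarrow> (ginv t, z) \<in> D \<and> (t, act (ginv t) z) \<in> D \<and>
        (g, act (ginv t) z) \<in> D \<and> (mul g (ginv t), z) \<in> D \<and>
        (t, act (mul g (ginv t)) z) \<in> D \<and> (\<kappa> g, z) \<in> D"
      by (rule eventually_nhds_prodE) auto
    have "\<forall>\<^sub>F g in nhds e. g \<in> \<Lambda>"
      by (rule eventually_\<Lambda>[OF filterlim_ident e_simps(1)])
    moreover have "\<forall>\<^sub>F g in nhds e. (ginv g, act g b2) \<in> D"
      using eventually_D[OF tendsto_ginv[OF filterlim_ident e_simps(1)]
          tendsto_act[OF filterlim_ident tendsto_const e_simps(2)[OF M(2)]]] M
      by (simp add: ginv_e e_simps)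
    moreover have "\<forall>\<^sub>F g in nhds e. (g, ginv t) \<in> \<Omega>"
      by (rule eventually_\<Omega>[OF filterlim_ident tendsto_const \<Omega>(1)])
    moreover have "\<forall>\<^sub>F g in nhds e. (t, mul g (ginv t)) \<in> \<Omega>"
      using eventually_\<Omega>[OF tendsto_const mul_lim[OF filterlim_ident] ti(3)] .
    moreover have "\<forall>\<^sub>F g in nhds e. \<forall>b' F'. prolonged_action D act n (\<kappa> g) (b1, F) (b', F') \<longrightarrow> R F'"
      using eventually_compose_filterlim[OF b1 \<kappa>_lim[OF filterlim_ident]] .
    moreover note Pg
    ultimately show "\<forall>\<^sub>F g in nhds e. \<forall>b' F'. prolonged_action D act n g (b2, F) (b', F') \<longrightarrow> R F'"
    proof (eventually_elim, intro allI impI)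
      fix g b' F'
      assume g: "g \<in> \<Lambda>" "(ginv g, act g b2) \<in> D" "(g, ginv t) \<in> \<Omega>" "(t, mul g (ginv t)) \<in> \<Omega>" "Pg g"
        and R: "\<forall>b' F'. prolonged_action D act n (\<kappa> g) (b1, F) (b', F') \<longrightarrow> R F'"
        and pr: "prolonged_action D act n g (b2, F) (b', F')"
      have "((\<lambda>z. z + (b1 - b2)) \<longlongrightarrow> b2 + (b1 - b2)) (nhds b2)"
        by (intro tendsto_add filterlim_ident tendsto_const)
      then have "filterlim (\<lambda>z. z + (b1 - b2)) (nhds b1) (nhds b2)"
        by simp
      from eventually_compose_filterlim[OF Pb this]
      have "\<forall>\<^sub>F z in nhds b2. (\<kappa> g, z + (b1 - b2)) \<in> D \<and> act (\<kappa> g) (z + (b1 - b2)) = act g z + (b1 - b2)"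
      proof eventually_elim
        case (elim z)
        \<comment> \<open>\<open>y\<close> is the copy of \<open>z\<close> near \<open>b1\<close>:
          \<open>ginv t\<close> brings it back to \<open>z\<close>, \<open>g\<close> acts there, and
          \<open>t\<close> shifts the result by \<open>b1 - b2\<close>.\<close>
        define y where "y = z + (b1 - b2)"
        have D: "(ginv t, y) \<in> D" "(t, act (ginv t) y) \<in> D" "(g, act (ginv t) y) \<in> D"
          "(mul g (ginv t), y) \<in> D" "(t, act (mul g (ginv t)) y) \<in> D" "(\<kappa> g, y) \<in> D"
          using PD[OF g(5) elim] by (auto simp: y_def)
        have "act (ginv t) y = z"
          using t(2)[OF D(2)] act_act_ginv[OF t\<Lambda> D(1,2)] by (simp add: y_def algebra_simps)
        then have gz: "act (mul g (ginv t)) y = act g z"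
          using act_mul[OF D(1) g(3) D(3,4)] by simp
        have "act (\<kappa> g) y = act t (act (mul g (ginv t)) y)"
          unfolding \<kappa>_def by (rule act_mul[OF D(4) g(4) D(5) D(6)[unfolded \<kappa>_def]])
        also have "\<dots> = act g z + (b1 - b2)"
          using t(2)[OF D(5)] by (simp add: gz)
        finally show ?case
          using D(6) by (simp add: y_def)
      qed
      from prolonged_action_shift[OF pr g(1,2) this]
      have "prolonged_action D act n (\<kappa> g) (b1, F) (b' + (b1 - b2), F')"
        by simp
      with R show "R F'" by blast
    qed
  qed
qed

text \<open>The translation that cancels the displacement \<open>act g 0\<close> depends on
  \<open>g\<close>. The conditions on domains and on isotropy elements are therefore arranged
  jointly for \<open>t\<close>, \<open>g\<close> and the point before \<open>t\<close> is
  chosen.\<close>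

lemma invariance_at_origin:
  assumes iso: "\<forall>\<^sub>F h in nhds e. h \<in> isotropy D act 0 \<longrightarrow> (\<forall>G. power_series_action D act n h F G \<longrightarrow> R G)"
  shows "\<forall>\<^sub>F g in nhds e. \<forall>b' F'. prolonged_action D act n g (0, F) (b', F') \<longrightarrow> R F'"
proof -
  let ?N = "nhds ((e, e), 0 :: (real^'p) \<times> (real^'q))"
  note e_0 = e_simps(2)[OF origin]
  note lim = tendsto_projections
  have l: "((\<lambda>p. fst (fst p)) \<longlongrightarrow> e) ?N" "((\<lambda>p. snd (fst p)) \<longlongrightarrow> e) ?N"
    "(snd \<longlongrightarrow> 0) ?N"
    using tendsto_fst[OF lim(1)] tendsto_snd[OF lim(1)] lim(2) by fastforce+
  have ee: "(e, e) \<in> \<Omega>"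
    by (simp add: e_simps)
  have m: "((\<lambda>p. mul (fst (fst p)) (snd (fst p))) \<longlongrightarrow> e) ?N"
    using tendsto_mul[OF l(1,2) ee] by (simp add: e_simps)
  have "\<forall>\<^sub>F p in ?N. fst p \<in> \<Omega> \<and>
    (mul (fst (fst p)) (snd (fst p)) \<in> isotropy D act 0 \<longrightarrow>
      (\<forall>G. power_series_action D act n (mul (fst (fst p)) (snd (fst p))) F G \<longrightarrow> R G)) \<and>
    (snd (fst p), snd p) \<in> D \<and> (fst (fst p), act (snd (fst p)) (snd p)) \<in> D \<and>
    (mul (fst (fst p)) (snd (fst p)), snd p) \<in> D"
  proof (intro eventually_conj)
    have "((\<lambda>p. act (snd (fst p)) (snd p)) \<longlongrightarrow> 0) ?N"
      using tendsto_act[OF l(2,3) e_0] by (simp add: e_simps origin)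
    then show "\<forall>\<^sub>F p in ?N. (fst (fst p), act (snd (fst p)) (snd p)) \<in> D"
      by (rule eventually_D[OF l(1) _ e_0])
    show "\<forall>\<^sub>F p in ?N. fst p \<in> \<Omega>"
      using eventually_\<Omega>[OF l(1,2) ee] by simp
    show "\<forall>\<^sub>F p in ?N. mul (fst (fst p)) (snd (fst p)) \<in> isotropy D act 0 \<longrightarrow>
        (\<forall>G. power_series_action D act n (mul (fst (fst p)) (snd (fst p))) F G \<longrightarrow> R G)"
      using eventually_compose_filterlim[OF iso m] .
    show "\<forall>\<^sub>F p in ?N. (snd (fst p), snd p) \<in> D"
      by (rule eventually_D[OF l(2,3) e_0])
    show "\<forall>\<^sub>F p in ?N. (mul (fst (fst p)) (snd (fst p)), snd p) \<in> D"
      by (rule eventually_D[OF m l(3) e_0])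
  qed
  then obtain Q Pz where Q: "\<forall>\<^sub>F q in nhds (e, e). Q q" and Pz: "\<forall>\<^sub>F z in nhds 0. Pz z"
    and QP: "\<And>q z. Q q \<Longrightarrow> Pz z \<Longrightarrow> q \<in> \<Omega> \<and>
      (mul (fst q) (snd q) \<in> isotropy D act 0 \<longrightarrow>
        (\<forall>G. power_series_action D act n (mul (fst q) (snd q)) F G \<longrightarrow> R G)) \<and>
      (snd q, z) \<in> D \<and> (fst q, act (snd q) z) \<in> D \<and> (mul (fst q) (snd q), z) \<in> D"
    by (rule eventually_nhds_prodE) auto
  obtain Pt Pg where Pt: "\<forall>\<^sub>F t in nhds e. Pt t" and Pg: "\<forall>\<^sub>F g in nhds e. Pg g"
    and P: "\<And>t g. Pt t \<Longrightarrow> Pg g \<Longrightarrow> Q (t, g)"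
    using Q by (rule eventually_nhds_prodE) blast
  have act0: "((\<lambda>g. act g 0) \<longlongrightarrow> 0) (nhds e)"
    using tendsto_act[OF filterlim_ident tendsto_const e_0] by (simp add: e_simps origin)
  then have "((\<lambda>g. - act g 0) \<longlongrightarrow> 0) (nhds e)"
    using tendsto_minus by fastforce
  from eventually_compose_filterlim[OF contains_family_eventually[OF contains_translations Pt] this]
  have "\<forall>\<^sub>F g in nhds e. \<exists>t. Pt t \<and> (\<forall>z. (t, z) \<in> D \<longrightarrow> act t z = translation (- act g 0) z)" .
  moreover have "\<forall>\<^sub>F g in nhds e. g \<in> \<Lambda>"
    by (rule eventually_\<Lambda>[OF filterlim_ident e_simps(1)])
  moreover have "\<forall>\<^sub>F g in nhds e. (ginv g, act g 0) \<in> D"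
    using eventually_D[OF tendsto_ginv[OF filterlim_ident e_simps(1)] act0] e_0 by (simp add: ginv_e)
  moreover note Pg
  ultimately show ?thesis
  proof (eventually_elim, intro allI impI)
    fix g b' F'
    assume "\<exists>t. Pt t \<and> (\<forall>z. (t, z) \<in> D \<longrightarrow> act t z = translation (- act g 0) z)"
      and g: "g \<in> \<Lambda>" "(ginv g, act g 0) \<in> D" "Pg g" and pr: "prolonged_action D act n g (0, F) (b', F')"
    then obtain t where t: "Pt t" "\<And>z. (t, z) \<in> D \<Longrightarrow> act t z = z + - act g 0"
      unfolding translation_def by blast
    note q = QP[OF P[OF t(1) g(3)], unfolded fst_conv snd_conv]
    have ev: "\<forall>\<^sub>F z in nhds 0. (mul t g, z + 0) \<in> D \<and> act (mul t g) (z + 0) = act g z + - act g 0"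
      using Pz
    proof eventually_elim
      case (elim z)
      then show ?case
        using q[OF elim] act_mul[of g z t] t(2)[of "act g z"] by simp
    qed
    have "prolonged_action D act n (mul t g) (0 + 0, F) (b' + - act g 0, F')"
      by (rule prolonged_action_shift[OF pr g(1,2) ev])
    \<comment> \<open>The target base point \<open>b'\<close> equals \<open>act g 0\<close>, so the
      translation brings it back to 0.\<close>
    then have pr0: "prolonged_action D act n (mul t g) (0, F) (0, F')"
      using prolonged_action_imp(2)[OF pr] by simp
    have "mul t g \<in> isotropy D act 0"
      using prolonged_action_imp[OF pr0] by (simp add: isotropy_def)
    moreover have "power_series_action D act n (mul t g) F F'"
      using pr0 unfolding prolonged_action_def power_series_action_def jet_of_def
      by (auto simp: zero_prod_def)
    \<comment> \<open>\<open>q\<close> asks for a point satisfying \<open>Pz\<close>; 0 itself is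
      one.\<close>
    ultimately show "R F'"
      using q[OF eventually_nhds_x_imp_x[OF Pz]] by blast
  qed
qed

section \<open>Evaluation at the origin and its inverse\<close>

lemma eval_at_origin_power_series_invariant:
  assumes I: "I \<in> differential_invariants e D act n U"
  shows "eval_at_origin U I \<in> power_series_invariants e D act n (origin_fibre U)"
  unfolding power_series_invariants_def
proof (intro CollectI conjI ballI)
  show "eval_at_origin U I \<in> extensional (origin_fibre U)"
    by (simp add: eval_at_origin_def)
  fix F assume F: "F \<in> origin_fibre U"
  then have "(0, F) \<in> U"
    by (simp add: origin_fibre_def)
  from invariantD[OF I this]
  show "\<forall>\<^sub>F g in nhds e. g \<in> isotropy D act 0 \<longrightarrow> (\<forall>G\<in>origin_fibre U.
      power_series_action D act n g F G \<longrightarrow> eval_at_origin U I G = eval_at_origin U I F)"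
  proof (rule eventually_mono, intro impI ballI)
    fix g G
    assume inv: "\<forall>z'\<in>U. prolonged_action D act n g (0, F) z' \<longrightarrow> I z' = I (0, F)"
      and g: "g \<in> isotropy D act 0" and G: "G \<in> origin_fibre U" and psa: "power_series_action D act n g F G"
    obtain A u B v where "transforms_graph D act g A u B v" "0 \<in> A" "u 0 = 0" "0 \<in> B" "v 0 = 0"
      "F = taylor_coeffs n u 0" "G = taylor_coeffs n v 0"
      using psa unfolding power_series_action_def by blast
    \<comment> \<open>An isotropy element fixes the point of the graph over 0, so its power series
      action is a prolonged action between jets over 0.\<close>
    moreover from this have "act g (0, u 0) = (0, v 0)" "(0, F) = jet_of n u 0" "(0, G) = jet_of n v 0"
      using g by (simp_all add: isotropy_def jet_of_def zero_prod_def)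
    ultimately have "prolonged_action D act n g (0, F) (0, G)"
      unfolding prolonged_action_def by blast
    then have "I (0, G) = I (0, F)"
      using inv G by (simp add: origin_fibre_def)
    then show "eval_at_origin U I G = eval_at_origin U I F"
      using F G by (simp add: eval_at_origin_def)
  qed
qed

lemma power_series_invariant_extends:
  assumes U: "openin (top_of_set (jet_space M n)) U"
    and conn: "\<And>F. F \<in> snd ` U \<Longrightarrow> connected {b. (b, F) \<in> U}" and zero: "\<And>F. F \<in> snd ` U \<Longrightarrow> (0, F) \<in> U"
    and J: "J \<in> power_series_invariants e D act n (origin_fibre U)"
  shows "restrict (\<lambda>z. J (snd z)) U \<in> differential_invariants e D act n U"
  unfolding differential_invariants_def
proof (intro CollectI conjI ballI)
  fix z assume z: "z \<in> U"
  obtain b F where bF: "z = (b, F)" by (cases z)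
  have F: "F \<in> snd ` U"
    using z bF by force
  \<comment> \<open>\<open>J\<close> has meaning only on the origin fibre, so the requirement is
    vacuous for other target coefficients.\<close>
  define R where "R = (\<lambda>G. G \<in> origin_fibre U \<longrightarrow> J G = J F)"
  \<comment> \<open>Treated below as a truth-valued function on the fibre over \<open>F\<close>: it
    holds at 0 and is locally constant, hence holds at \<open>b\<close>.\<close>
  define P where "P = (\<lambda>b. \<forall>\<^sub>F g in nhds e. \<forall>b' F'. prolonged_action D act n g (b, F) (b', F') \<longrightarrow> R F')"
  have F0: "F \<in> origin_fibre U"
    using zero[OF F] by (simp add: origin_fibre_def)
  have "\<forall>\<^sub>F h in nhds e. h \<in> isotropy D act 0 \<longrightarrow> (\<forall>G. power_series_action D act n h F G \<longrightarrow> R G)"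
  proof (rule eventually_mono)
    show "\<forall>\<^sub>F h in nhds e. h \<in> isotropy D act 0 \<longrightarrow>
        (\<forall>G\<in>origin_fibre U. power_series_action D act n h F G \<longrightarrow> J G = J F)"
      using J F0 unfolding power_series_invariants_def by simp
  qed (auto simp: R_def)
  then have "P 0"
    unfolding P_def by (rule invariance_at_origin)
  moreover have "P b = P 0"
  proof (rule connected_eventually_constant[OF conn[OF F], of P])
    fix a assume "a \<in> {b. (b, F) \<in> U}"
    then have "a \<in> M"
      using jet_domain[OF U] by blast
    \<comment> \<open>Exchanging \<open>b1\<close> and \<open>b2\<close> gives both implications,
      hence equality of truth values on \<open>N\<close>.\<close>
    then obtain N where N: "open N" "a \<in> N" "\<And>b1 b2. b1 \<in> N \<Longrightarrow> b2 \<in> N \<Longrightarrow> P b1 \<Longrightarrow> P b2"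
      unfolding P_def using invariance_local[where n = n and F = F and R = R] by blast
    have "\<forall>\<^sub>F x in nhds a. x \<in> N"
      using N by (intro eventually_nhds_in_open)
    then show "\<forall>\<^sub>F x in nhds a. x \<in> {b. (b, F) \<in> U} \<longrightarrow> P x = P a"
      by (rule eventually_mono) (use N(2,3) in blast)
  qed (use z bF zero[OF F] in auto)
  ultimately have "P b" by simp
  then show "\<forall>\<^sub>F g in nhds e. \<forall>z'\<in>U. prolonged_action D act n g z z' \<longrightarrow>
      restrict (\<lambda>z. J (snd z)) U z' = restrict (\<lambda>z. J (snd z)) U z"
    unfolding P_def
  proof (rule eventually_mono, intro ballI impI)
    fix g z'
    assume R: "\<forall>b' F'. prolonged_action D act n g (b, F) (b', F') \<longrightarrow> R F'"
      and z': "z' \<in> U" and pr: "prolonged_action D act n g z z'"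
    \<comment> \<open>Every coefficient family occurring in \<open>U\<close> also occurs over 0, so
      \<open>R\<close> is not vacuous for \<open>F'\<close>.\<close>
    obtain b' F' where z'_eq: "z' = (b', F')" by (cases z')
    have "F' \<in> snd ` U"
      using z' z'_eq by force
    then have "F' \<in> origin_fibre U"
      using zero by (simp add: origin_fibre_def)
    moreover have "R F'"
      using R pr bF z'_eq by blast
    ultimately show "restrict (\<lambda>z. J (snd z)) U z' = restrict (\<lambda>z. J (snd z)) U z"
      using z z' by (simp add: R_def bF z'_eq)
  qed
qed simp

text \<open>The inverse extends a function on the origin fibre by forgetting the base point; that it
  inverts evaluation is the constancy of invariants along each connected fibre through 0.\<close>

lemma bij_betw_eval_at_origin:
  assumes U: "openin (top_of_set (jet_space M n)) U"
    and conn: "\<And>F. F \<in> snd ` U \<Longrightarrow> connected {b. (b, F) \<in> U}" and zero: "\<And>F. F \<in> snd ` U \<Longrightarrow> (0, F) \<in> U"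
  shows "bij_betw (eval_at_origin U) (differential_invariants e D act n U)
    (power_series_invariants e D act n (origin_fibre U))"
proof (rule bij_betwI)
  show "eval_at_origin U \<in> differential_invariants e D act n U \<rightarrow> power_series_invariants e D act n (origin_fibre U)"
    using eval_at_origin_power_series_invariant by blast
  show "(\<lambda>J. restrict (\<lambda>z. J (snd z)) U) \<in>
      power_series_invariants e D act n (origin_fibre U) \<rightarrow> differential_invariants e D act n U"
    using power_series_invariant_extends[OF U conn zero] by blast
next
  fix I assume I: "I \<in> differential_invariants e D act n U"
  show "restrict (\<lambda>z. eval_at_origin U I (snd z)) U = I"
  proof (rule extensionalityI[of _ U])
    fix z assume z: "z \<in> U"
    obtain b F where bF: "z = (b, F)" by (cases z)
    have F: "F \<in> snd ` U"
      using z bF by force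
    have "I (0, F) = I (b, F)"
      by (rule invariant_const_on_fibre[OF U I conn[OF F]]) (use z bF zero[OF F] in auto)
    then show "restrict (\<lambda>z. eval_at_origin U I (snd z)) U z = I z"
      using z zero[OF F] by (simp add: bF eval_at_origin_def origin_fibre_def)
  qed (use I in \<open>simp_all add: differential_invariants_def\<close>)
next
  fix J assume J: "J \<in> power_series_invariants e D act n (origin_fibre U)"
  show "eval_at_origin U (restrict (\<lambda>z. J (snd z)) U) = J"
  proof (rule extensionalityI[of _ "origin_fibre U"])
    show "eval_at_origin U (restrict (\<lambda>z. J (snd z)) U) F = J F" if "F \<in> origin_fibre U" for F
      using that by (simp add: eval_at_origin_def origin_fibre_def)
  qed (use J in \<open>simp_all add: power_series_invariants_def eval_at_origin_def\<close>)
qed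

end

text \<open>A locally constant function may take different values on different components of a
  fibre, so the global statements carry connectedness conditions on \<open>U\<close>. That each
  fibre contains the origin lets evaluation there see all of \<open>U\<close>.\<close>

theorem theorem12p6:
  fixes V \<Lambda> :: "'g::euclidean_space set"
    and \<Omega> :: "('g \<times> 'g) set"
    and e :: 'g
    and mul :: "'g \<Rightarrow> 'g \<Rightarrow> 'g"
    and ginv :: "'g \<Rightarrow> 'g"
    and M :: "((real^'p) \<times> (real^'q)) set"
    and D :: "('g \<times> ((real^'p) \<times> (real^'q))) set"
    and act :: "'g \<Rightarrow> (real^'p) \<times> (real^'q) \<Rightarrow> (real^'p) \<times> (real^'q)"
  assumes "local_lie_group V e \<Omega> mul \<Lambda> ginv"
    and "local_action V e \<Omega> mul M D act"
    and "0 \<in> M"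
    and "contains_family e D act translation"
    and "contains_family e D act transvection"
  shows "\<forall>n.
    (\<forall>U I. openin (top_of_set (jet_space M n)) U \<and> I \<in> differential_invariants e D act n U \<longrightarrow>
       (\<forall>z\<in>U. \<exists>U'. openin (top_of_set U) U' \<and> z \<in> U' \<and> depends_only_on_higher U' I) \<and>
       ((\<forall>w. connected {z \<in> U. higher_coords z = w}) \<longrightarrow> depends_only_on_higher U I)) \<and>
    (\<forall>U. openin (top_of_set (jet_space M n)) U \<and>
         (\<forall>F\<in>snd ` U. connected {b. (b, F) \<in> U} \<and> (0, F) \<in> U) \<longrightarrow>
       bij_betw (eval_at_origin U)
         (differential_invariants e D act n U)
         (power_series_invariants e D act n (origin_fibre U)))"
proof -
  interpret translation_transvection_action V \<Lambda> \<Omega> e mul ginv M D act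
    by standard (fact assms)+
  show ?thesis
  proof (intro allI conjI impI ballI)
    fix n U I z
    assume "openin (top_of_set (jet_space M n)) U \<and> I \<in> differential_invariants e D act n U" and "z \<in> U"
    then show "\<exists>U'. openin (top_of_set U) U' \<and> z \<in> U' \<and> depends_only_on_higher U' I"
      by (intro invariant_locally_higher[where n = n]) auto
  next
    fix n U I
    assume "openin (top_of_set (jet_space M n)) U \<and> I \<in> differential_invariants e D act n U"
      and "\<forall>w. connected {z \<in> U. higher_coords z = w}"
    then show "depends_only_on_higher U I"
      by (intro invariant_globally_higher[where n = n]) auto
  next
    fix n U
    assume "openin (top_of_set (jet_space M n)) U \<and> (\<forall>F\<in>snd ` U. connected {b. (b, F) \<in> U} \<and> (0, F) \<in> U)"
    then show "bij_betw (eval_at_origin U) (differential_invariants e D act n U)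
        (power_series_invariants e D act n (origin_fibre U))"
      by (intro bij_betw_eval_at_origin) blast+
  qed
qed

end
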